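(* Let $F$ be a coquasitriangular face Hopf algebra over $\mathbb{C}$ with finite vertex set, with coquasitriangular structure $R$, let $U$ be its dual algebra, and let $T\in U\otimes F$ be the universal $T$ (all as defined in the context). Then: (i) The set $I=\{f\in F:\ \sum f_{(1)}\otimes f_{(2)}=\sum f_{(2)}\otimes f_{(1)}\}$ of cocommutative elements of $F$ is a commutative subalgebra of $F$. (ii) The Heisenberg equations of motion defined by a Hamiltonian $\mathcal{H}\in I$ are of Lax form $$ i\,\frac{dT}{dt}=\left[M^{\pm},T\right] $$ (for either choice of sign), where $$M^{\pm}=1\otimes\mathcal{H}-m_{\pm}\in U_{\pm}\otimes F,\qquad m_{\pm}=\sum R^{\pm}(\mathcal{H}_{(2)})\otimes\mathcal{H}_{(1)} .$$ (iii) Let $\mathcal{H}\in I$ and let $g_{\pm}(t)\in U_{\pm}\otimes F$ be the solutions to the factorization problem $$ g_-^{-1}(t)\,g_+(t)=\exp\big(it(m_+-m_-)\big)\in U\otimes F .$$ Then (for either choice of sign) $$ T(t)=g_{\pm}(t)\,T(0)\,g_{\pm}(t)^{-1} $$ solves the Lax equation $i\,\frac{dT}{dt}=[M^{\pm},T]$ of (ii). Moreover, $g_{\pm}(t)$ are given by $$ g_{\pm}(t)=\exp\big(-it(1\otimes\mathcal{H})\big)\,\exp\big(it(1\otimes\mathcal{H}-M^{\pm}(0))\big) $$ and are the solutions to the differential equation $$ i\,\frac{d}{dt}g_{\pm}(t)=M^{\pm}(t)\,g_{\pm}(t),\qquad g_{\pm}(0)=1. $$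
   Context: **Face Hopf algebra.** Let $V$ be a finite set (the vertices). A face Hopf algebra over $\mathbb{C}$ with vertex set $V$ is a unital associative algebra $F$ which is also a coalgebra $(\Delta,\epsilon)$ (Sweedler notation $\Delta(f)=\sum f_{(1)}\otimes f_{(2)}$), with elements $e_i,e^i\in F$ ($i\in V$) and a linear map $S:F\to F$ (antipode) such that, for all $a,b\in F$ and $i,j\in V$: - $\Delta(ab)=\Delta(a)\Delta(b)$; - $e_ie_j=\delta_{ij}e_i$, $e^ie^j=\delta_{ij}e^i$, $e_ie^j=e^je_i$, $\sum_i e_i=\sum_i e^i=1$; - $\Delta(e^ie_j)=\sum_k e^ie_k\otimes e^ke_j$ and $\epsilon(e^ie_j)=\delta_{ij}$ (so $\Delta(1)=\sum_k e_k\otimes e^k$, in general $\neq 1\otimes 1$); - $\epsilon(ab)=\sum_k\epsilon(ae_k)\,\epsilon(e^kb)$; - $S$ is an anti-algebra and anti-coalgebra map with $\sum S(a_{(1)})a_{(2)}=\sum_k\epsilon(ae_k)e_k$, $\ \sum a_{(1)}S(a_{(2)})=\sum_k\epsilon(e^ka)e^k$, $\ \sum S(a_{(1)})a_{(2)}S(a_{(3)})=S(a)$. **The dual $U$.** $U$ is the dual of $F$ with product $\langle xy,f\rangle=\sum\langle x,f_{(1)}\rangle\langle y,f_{(2)}\rangle$ and unit $1_U=\epsilon$. Elements of $U\otimes U$ (completed where needed) are regarded as linear functionals on $F\otimes F$, multiplied by convolution with respect to the tensor product coalgebra $F\otimes F$. The coproduct of $U$ is $\langle\Delta(x),a\otimes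 b\rangle=\langle x,ab\rangle$, and $\Delta'$ is the opposite coproduct; thus $\Delta(1_U)$ is $a\otimes b\mapsto\epsilon(ab)$ and $\Delta'(1_U)$ is $a\otimes b\mapsto\epsilon(ba)$. **Coquasitriangular structure.** A coquasitriangular structure on $F$ is a linear functional $R$ on $F\otimes F$ (an element of $U\otimes U$, possibly completed) which, with $\tilde R:=(S\otimes \mathrm{id})(R)$, i.e. $\tilde R(a\otimes b)=R(S(a)\otimes b)$, satisfies for all $a,b,c\in F$: - $\sum R(a_{(1)}\otimes b_{(1)})\,a_{(2)}b_{(2)}=\sum b_{(1)}a_{(1)}\,R(a_{(2)}\otimes b_{(2)})$, and $\sum\tilde R(a_{(1)}\otimes b_{(1)})\,b_{(2)}a_{(2)}=\sum a_{(1)}b_{(1)}\,\tilde R(a_{(2)}\otimes b_{(2)})$; - $\tilde R R=\Delta(1_U)$, $\ R\tilde R=\Delta'(1_U)$ (convolution products), and $R=R\,\Delta(1_U)=\Delta'(1_U)\,R$, $\ \tilde R=\tilde R\,\Delta'(1_U)=\Delta(1_U)\,\tilde R$; - $R(ab\otimes c)=\sum R(a\otimes c_{(1)})R(b\otimes c_{(2)})$, $\ R(a\otimes bc)=\sum R(a_{(1)}\otimes c)R(a_{(2)}\otimes b)$. **The maps $R^{\pm}$.** $R^{\pm}:F\to U$ are the algebra homomorphisms $R^+(f)=\langle R,f\otimes\mathrm{id}\rangle$, i.e. $\langle R^+(f),a\rangle=R(f\otimes a)$, and $R^-(f)=\langle\tilde R,\mathrm{id}\otimes f\rangle$, i.e.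 $\langle R^-(f),a\rangle=\tilde R(a\otimes f)=R(S(a)\otimes f)$. Put $U_{\pm}=R^{\pm}(F)\subset U$. **Universal $T$ and the algebra "$U\otimes F$".** An element $X$ of $U\otimes F$ is identified with the linear map $F\to F$, $f\mapsto\langle X,f\otimes\mathrm{id}\rangle$ ($x\otimes a$ corresponds to $f\mapsto\langle x,f\rangle a$). Accordingly "$U\otimes F$" denotes the algebra of linear maps $F\to F$ under convolution $(XY)(f)=\sum X(f_{(1)})Y(f_{(2)})$, with unit $1=1_U\otimes 1_F:f\mapsto\epsilon(f)1$. The universal $T$ is the element corresponding to the identity map $F\to F$. Commutators, inverses and exponentials are taken in this algebra; exponentials and functions of $t$ are understood as formal power series in $t$ (so "$\in U_\pm\otimes F$" for such a series means coefficientwise). **Time evolution.** For a Hamiltonian $\mathcal{H}\in F$ the Heisenberg equation of motion for $f\in F$ is $i\,df/dt=[\mathcal{H},f]$, with solution $f(t)=e^{-it\mathcal{H}}fe^{it\mathcal{H}}$. For $X\in U\otimes F$ the evolution acts on the $F$-factor: $i\,dX/dt=[1\otimes\mathcal{H},X]$, $X(t)=e^{-it(1\otimes\mathcal{H})}\,X\,e^{it(1\otimes\mathcal{H})}$, $X(0)=X$. In particular $M^{\pm}(t)$ denotes the Heisenberg-evolved $M^\pm$, with $M^\pm(0)=M^\pm$, and $T(0)=T$; in the Lax equation, $T$ and $M^\pm$ are taken at time $t$. "Subalgebra" in (i) means a linear subspace closed under multiplication (it need not contain $1$).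
   Formalization: In (iii) the factorization problem does not determine g_± (for H=0, g_+=g_-=1+t also solves it), so the claims are proved for the g_± given by the stated formula; every other solution is shown to differ from it by a common invertible left factor in both U_±⊗F. *)

theory Defs
  imports
    Complex_Main
    "HOL-Library.Poly_Mapping"
    "HOL-Computational_Algebra.Formal_Power_Series"
begin

section \<open>Complex vector spaces and algebras\<close>

class scaleC =
  fixes scaleC :: "complex \<Rightarrow> 'a \<Rightarrow> 'a" (infixr \<open>*\<^sub>C\<close> 75)

class complex_vector = scaleC + ab_group_add +
  assumes scaleC_add_right: "a *\<^sub>C (x + y) = a *\<^sub>C x + a *\<^sub>C y"
    and scaleC_add_left: "(a + b) *\<^sub>C x = a *\<^sub>C x + b *\<^sub>C x"
    and scaleC_scaleC [simp]: "a *\<^sub>C b *\<^sub>C x = (a * b) *\<^sub>C x"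
    and scaleC_one [simp]: "1 *\<^sub>C x = x"

class complex_algebra_1 = complex_vector + ring_1 +
  assumes mult_scaleC_left [simp]: "a *\<^sub>C x * y = a *\<^sub>C (x * y)"
    and mult_scaleC_right [simp]: "x * a *\<^sub>C y = a *\<^sub>C (x * y)"

instantiation complex :: complex_algebra_1
begin

definition scaleC_complex_def [simp]: "scaleC a (x::complex) = a * x"

instance
  by standard (simp_all add: algebra_simps)

end

global_interpretation complex_vector: vector_space "scaleC :: complex \<Rightarrow> 'a \<Rightarrow> 'a::complex_vector"
  by unfold_locales (simp_all add: scaleC_add_right scaleC_add_left)

abbreviation clinear :: "('a::complex_vector \<Rightarrow> 'b::complex_vector) \<Rightarrow> bool" where
  "clinear \<equiv> Vector_Spaces.linear scaleC scaleC"

lemma clinearI: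
  assumes "\<And>x y. f (x + y) = f x + f y" "\<And>c x. f (c *\<^sub>C x) = c *\<^sub>C f x"
  shows "clinear f"
  by unfold_locales (use assms in \<open>auto simp: scaleC_add_right scaleC_add_left\<close>)

lemma clinear_module_hom: "clinear f \<Longrightarrow> module_hom scaleC scaleC f"
  by (simp add: Vector_Spaces.linear_def)

lemmas clinear_add = module_hom.add[OF clinear_module_hom]
lemmas clinear_scale = module_hom.scale[OF clinear_module_hom]
lemmas clinear_0 = module_hom.zero[OF clinear_module_hom]
lemmas clinear_diff = module_hom.diff[OF clinear_module_hom]

definition cbilinear :: "('a::complex_vector \<Rightarrow> 'b::complex_vector \<Rightarrow> 'c::complex_vector) \<Rightarrow> bool" where
  "cbilinear B \<longleftrightarrow> (\<forall>a. clinear (B a)) \<and> (\<forall>b. clinear (\<lambda>a. B a b))"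

named_theorems lin_intros

lemma cbilinearI [lin_intros]:
  "(\<And>a. clinear (\<lambda>b. B a b)) \<Longrightarrow> (\<And>b. clinear (\<lambda>a. B a b)) \<Longrightarrow> cbilinear (\<lambda>a b. B a b)"
  by (simp add: cbilinear_def)

lemma clinear_id [lin_intros]: "clinear (\<lambda>x. x)"
  by (rule clinearI) auto

lemma clinear_zero [lin_intros]: "clinear (\<lambda>x. 0)"
  by (rule clinearI) auto

lemma clinear_plus [lin_intros]: "clinear f \<Longrightarrow> clinear g \<Longrightarrow> clinear (\<lambda>x. f x + g x)"
  by (rule clinearI) (auto simp: clinear_add clinear_scale scaleC_add_right)

lemma clinear_uminus [lin_intros]: "clinear f \<Longrightarrow> clinear (\<lambda>x. - f x)"
  by (rule clinearI) (auto simp: clinear_add clinear_scale)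

lemma clinear_minus' [lin_intros]: "clinear f \<Longrightarrow> clinear g \<Longrightarrow> clinear (\<lambda>x. f x - g x)"
  by (rule clinearI) (auto simp: clinear_add clinear_scale complex_vector.scale_right_diff_distrib)

lemma clinear_scaleC [lin_intros]: "clinear f \<Longrightarrow> clinear (\<lambda>x. c *\<^sub>C f x)"
  by (rule clinearI) (auto simp: clinear_add clinear_scale scaleC_add_right mult.commute)

lemma clinear_scaleC_left [lin_intros]: "clinear f \<Longrightarrow> clinear (\<lambda>x. f x *\<^sub>C v)"
  by (rule clinearI) (auto simp: clinear_add clinear_scale scaleC_add_left)

lemma clinear_mult_left [lin_intros]:
  fixes f :: "_ \<Rightarrow> 'a::complex_algebra_1"
  shows "clinear f \<Longrightarrow> clinear (\<lambda>x. f x * y)"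
  by (rule clinearI) (auto simp: clinear_add clinear_scale distrib_right)

lemma clinear_mult_right [lin_intros]:
  fixes f :: "_ \<Rightarrow> 'a::complex_algebra_1"
  shows "clinear f \<Longrightarrow> clinear (\<lambda>x. y * f x)"
  by (rule clinearI) (auto simp: clinear_add clinear_scale distrib_left)


section \<open>Algebraic tensor products\<close>

text \<open>The tensor product is the free vector space on pairs modulo the bilinearity relations.\<close>

instantiation poly_mapping :: (type, complex_vector) complex_vector
begin

lift_definition scaleC_poly_mapping :: "complex \<Rightarrow> ('a \<Rightarrow>\<^sub>0 'b) \<Rightarrow> 'a \<Rightarrow>\<^sub>0 'b"
  is "\<lambda>c f x. c *\<^sub>C f x"
  by (rule rev_finite_subset) auto

instance
  by standard (transfer; auto simp: scaleC_add_right scaleC_add_left)+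

end

abbreviation free_pair :: "'a \<Rightarrow> 'b \<Rightarrow> ('a \<times> 'b) \<Rightarrow>\<^sub>0 complex" where
  "free_pair a b \<equiv> Poly_Mapping.single (a, b) 1"

definition tensor_relations :: "(('a::complex_vector \<times> 'b::complex_vector) \<Rightarrow>\<^sub>0 complex) set" where
  "tensor_relations =
     {free_pair (a + a') b - (free_pair a b + free_pair a' b) | a a' b. True} \<union>
     {free_pair a (b + b') - (free_pair a b + free_pair a b') | a b b'. True} \<union>
     {free_pair (c *\<^sub>C a) b - c *\<^sub>C free_pair a b | c a b. True} \<union>
     {free_pair a (c *\<^sub>C b) - c *\<^sub>C free_pair a b | c a b. True}"

definition tensor_eq ::
    "(('a::complex_vector \<times> 'b::complex_vector) \<Rightarrow>\<^sub>0 complex) \<Rightarrow> (('a \<times> 'b) \<Rightarrow>\<^sub>0 complex) \<Rightarrow> bool" where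
  "tensor_eq p q \<longleftrightarrow> p - q \<in> complex_vector.span tensor_relations"

lemma tensor_eq_equivp: "equivp tensor_eq"
proof (rule equivpI)
  show "reflp tensor_eq"
    by (auto simp: reflp_def tensor_eq_def complex_vector.span_zero)
  show "symp tensor_eq"
    unfolding symp_def tensor_eq_def by (metis complex_vector.span_neg minus_diff_eq)
  show "transp tensor_eq"
  proof (rule transpI)
    fix p q r assume "tensor_eq p q" "tensor_eq q r"
    then have "(p - q) + (q - r) \<in> complex_vector.span tensor_relations"
      unfolding tensor_eq_def by (rule complex_vector.span_add)
    then show "tensor_eq p r" by (simp add: tensor_eq_def)
  qed
qed

quotient_type (overloaded) ('a, 'b) tensor =
  "(('a::complex_vector \<times> 'b::complex_vector) \<Rightarrow>\<^sub>0 complex)" / tensor_eq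
  by (rule tensor_eq_equivp)

instantiation tensor :: (complex_vector, complex_vector) complex_vector
begin

lift_definition zero_tensor :: "('a, 'b) tensor" is 0 .

lift_definition plus_tensor :: "('a, 'b) tensor \<Rightarrow> ('a, 'b) tensor \<Rightarrow> ('a, 'b) tensor" is "(+)"
  unfolding tensor_eq_def by (metis add_diff_add complex_vector.span_add)

lift_definition uminus_tensor :: "('a, 'b) tensor \<Rightarrow> ('a, 'b) tensor" is uminus
  unfolding tensor_eq_def by (metis complex_vector.span_neg minus_diff_minus)

lift_definition minus_tensor :: "('a, 'b) tensor \<Rightarrow> ('a, 'b) tensor \<Rightarrow> ('a, 'b) tensor" is "(-)"
proof -
  fix p p' q q' :: "('a \<times> 'b) \<Rightarrow>\<^sub>0 complex"
  assume "tensor_eq p p'" "tensor_eq q q'"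
  then have "(p - p') - (q - q') \<in> complex_vector.span tensor_relations"
    unfolding tensor_eq_def by (rule complex_vector.span_diff)
  then show "tensor_eq (p - q) (p' - q')"
    by (simp add: tensor_eq_def algebra_simps)
qed

lift_definition scaleC_tensor :: "complex \<Rightarrow> ('a, 'b) tensor \<Rightarrow> ('a, 'b) tensor" is scaleC
  unfolding tensor_eq_def
  by (metis complex_vector.scale_right_diff_distrib complex_vector.span_scale)

instance
  by standard
    (transfer; simp add: tensor_eq_def complex_vector.span_zero algebra_simps
       scaleC_add_right scaleC_add_left)+

end

lift_definition tensor_pure :: "'a::complex_vector \<Rightarrow> 'b::complex_vector \<Rightarrow> ('a, 'b) tensor" (infixr \<open>\<otimes>\<close> 66)
  is free_pair .

lemma clinear_pure_left [lin_intros]: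
  assumes f: "clinear f" shows "clinear (\<lambda>x. f x \<otimes> b)"
proof (rule clinearI)
  have *: "(a + a') \<otimes> b = a \<otimes> b + a' \<otimes> b" for a a'
    by transfer (unfold tensor_eq_def tensor_relations_def, rule complex_vector.span_base, blast)
  show "f (x + y) \<otimes> b = f x \<otimes> b + f y \<otimes> b" for x y
    by (simp add: clinear_add[OF f] *)
  have *: "(c *\<^sub>C a) \<otimes> b = c *\<^sub>C (a \<otimes> b)" for c a
    by transfer (unfold tensor_eq_def tensor_relations_def, rule complex_vector.span_base, blast)
  show "f (c *\<^sub>C x) \<otimes> b = c *\<^sub>C (f x \<otimes> b)" for c x
    by (simp add: clinear_scale[OF f] *)
qed

lemma clinear_pure_right [lin_intros]:
  assumes f: "clinear f" shows "clinear (\<lambda>x. a \<otimes> f x)"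
proof (rule clinearI)
  have *: "a \<otimes> (b + b') = a \<otimes> b + a \<otimes> b'" for b b'
    by transfer (unfold tensor_eq_def tensor_relations_def, rule complex_vector.span_base, blast)
  show "a \<otimes> f (x + y) = a \<otimes> f x + a \<otimes> f y" for x y
    by (simp add: clinear_add[OF f] *)
  have *: "a \<otimes> (c *\<^sub>C b) = c *\<^sub>C (a \<otimes> b)" for c b
    by transfer (unfold tensor_eq_def tensor_relations_def, rule complex_vector.span_base, blast)
  show "a \<otimes> f (c *\<^sub>C x) = c *\<^sub>C (a \<otimes> f x)" for c x
    by (simp add: clinear_scale[OF f] *)
qed

definition free_lift :: "('a \<Rightarrow> 'b \<Rightarrow> 'c::complex_vector) \<Rightarrow> (('a \<times> 'b) \<Rightarrow>\<^sub>0 complex) \<Rightarrow> 'c" where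
  "free_lift B p = (\<Sum>k\<in>Poly_Mapping.keys p. Poly_Mapping.lookup p k *\<^sub>C B (fst k) (snd k))"

lemma free_lift_superset:
  assumes "finite K" "Poly_Mapping.keys p \<subseteq> K"
  shows "free_lift B p = (\<Sum>k\<in>K. Poly_Mapping.lookup p k *\<^sub>C B (fst k) (snd k))"
  unfolding free_lift_def
  by (rule sum.mono_neutral_left) (use assms in \<open>auto simp: in_keys_iff\<close>)

lemma clinear_free_lift: "clinear (free_lift B)"
proof (rule clinearI)
  fix p q :: "('a \<times> 'b) \<Rightarrow>\<^sub>0 complex" and c :: complex
  let ?K = "Poly_Mapping.keys p \<union> Poly_Mapping.keys q"
  have "Poly_Mapping.keys (p + q) \<subseteq> ?K" by (rule Poly_Mapping.keys_add)
  then show "free_lift B (p + q) = free_lift B p + free_lift B q"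
    by (simp add: free_lift_superset[of ?K] lookup_add scaleC_add_left sum.distrib)
  have "Poly_Mapping.keys (c *\<^sub>C p) \<subseteq> Poly_Mapping.keys p"
    by (auto simp: in_keys_iff scaleC_poly_mapping.rep_eq)
  then show "free_lift B (c *\<^sub>C p) = c *\<^sub>C free_lift B p"
    by (simp add: free_lift_superset[of "Poly_Mapping.keys p"] scaleC_poly_mapping.rep_eq
        complex_vector.scale_sum_right)
qed

lemma free_lift_pair [simp]: "free_lift B (free_pair a b) = B a b"
  by (simp add: free_lift_def)

lemma free_lift_cong_tensor_eq:
  assumes B: "cbilinear B" and eq: "tensor_eq p q"
  shows "free_lift B p = free_lift B q"
proof -
  note lin = clinear_free_lift[of B]
  have lin1: "clinear (B a)" and lin2: "clinear (\<lambda>a. B a b)" for a b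
    using B by (auto simp: cbilinear_def)
  have rel: "free_lift B r = 0" if "r \<in> tensor_relations" for r
    using that unfolding tensor_relations_def
    by (auto simp: clinear_diff[OF lin] clinear_add[OF lin] clinear_scale[OF lin]
        clinear_add[OF lin1] clinear_add[OF lin2] clinear_scale[OF lin1] clinear_scale[OF lin2])
  have "p - q \<in> complex_vector.span tensor_relations"
    using eq by (simp add: tensor_eq_def)
  then have "free_lift B (p - q) = 0"
    by (induct rule: complex_vector.span_induct_alt)
       (auto simp: clinear_0[OF lin] clinear_add[OF lin] clinear_scale[OF lin] rel)
  then show ?thesis by (simp add: clinear_diff[OF lin])
qed

text \<open>The linear map on the tensor product induced by a bilinear map (and 0 if the given map is
  not bilinear). If \<open>t\<close> is a coproduct \<open>\<Sum> a\<^sub>1 \<otimes> a\<^sub>2\<close> then \<open>tensor_lift B t\<close> is the Sweedler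
  sum \<open>\<Sum> B a\<^sub>1 a\<^sub>2\<close>.\<close>

lift_definition tensor_lift ::
    "('a::complex_vector \<Rightarrow> 'b::complex_vector \<Rightarrow> 'c::complex_vector) \<Rightarrow> ('a, 'b) tensor \<Rightarrow> 'c"
  is "\<lambda>B p. if cbilinear B then free_lift B p else 0"
  using free_lift_cong_tensor_eq by auto

lemma tensor_lift_pure: "cbilinear B \<Longrightarrow> tensor_lift B (a \<otimes> b) = B a b"
  by transfer simp

lemma clinear_tensor_lift0: "clinear (tensor_lift B)"
proof (rule clinearI)
  note lin = clinear_free_lift
  show "tensor_lift B (x + y) = tensor_lift B x + tensor_lift B y" for x y
    by transfer (simp add: clinear_add[OF lin])
  show "tensor_lift B (c *\<^sub>C x) = c *\<^sub>C tensor_lift B x" for c x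
    by transfer (simp add: clinear_scale[OF lin])
qed

lemma clinear_compose: "clinear L \<Longrightarrow> clinear f \<Longrightarrow> clinear (\<lambda>x. L (f x))"
  by (rule clinearI) (auto simp: clinear_add clinear_scale)

lemmas clinear_tensor_lift [lin_intros] = clinear_compose[OF clinear_tensor_lift0]

lemma free_expand: "p = (\<Sum>k\<in>Poly_Mapping.keys p. Poly_Mapping.lookup p k *\<^sub>C free_pair (fst k) (snd k))"
  by (rule poly_mapping_eqI)
     (auto simp: lookup_sum scaleC_poly_mapping.rep_eq lookup_single when_def in_keys_iff
       if_distrib sum.delta' cong: if_cong)

lemma free_span: "p \<in> complex_vector.span (range (\<lambda>k. free_pair (fst k) (snd k)))"
  by (subst free_expand, rule complex_vector.span_sum, rule complex_vector.span_scale,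
      rule complex_vector.span_base, rule rangeI)

lemma tensor_induct [case_names zero add]:
  assumes "P 0" and "\<And>a b t. P t \<Longrightarrow> P (a \<otimes> b + t)"
  shows "P t"
proof -
  have "P (abs_tensor p)" for p
    using free_span[of p]
  proof (induct rule: complex_vector.span_induct_alt)
    case base
    show ?case using assms(1) by (simp add: zero_tensor.abs_eq)
  next
    case (step c x y)
    then obtain a b where x: "x = free_pair a b" by auto
    have "abs_tensor (c *\<^sub>C x + y) = c *\<^sub>C (a \<otimes> b) + abs_tensor y"
      by (simp add: x plus_tensor.abs_eq scaleC_tensor.abs_eq tensor_pure.abs_eq)
    also have "c *\<^sub>C (a \<otimes> b) = (c *\<^sub>C a) \<otimes> b"
      by (rule clinear_scale[OF clinear_pure_left[OF clinear_id], symmetric])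
    finally show ?case using assms(2)[OF step(2)] by simp
  qed
  then have "P (abs_tensor (rep_tensor t))" .
  then show ?thesis by (simp only: Quotient3_abs_rep[OF Quotient3_tensor])
qed

lemma tensor_ext:
  assumes L: "clinear L" and M: "clinear M" and "\<And>a b. L (a \<otimes> b) = M (a \<otimes> b)"
  shows "L t = M t"
  by (induct t rule: tensor_induct)
     (auto simp: clinear_0[OF L] clinear_0[OF M] clinear_add[OF L] clinear_add[OF M] assms(3))

lemma clinear_apply_tensor_lift:
  assumes L: "clinear L" and B: "cbilinear B"
  shows "L (tensor_lift B t) = tensor_lift (\<lambda>a b. L (B a b)) t"
proof -
  have lin: "clinear (\<lambda>b. B a b)" "clinear (\<lambda>a. B a b)" for a b
    using B by (auto simp: cbilinear_def)
  have LB: "cbilinear (\<lambda>a b. L (B a b))"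
    by (rule cbilinearI) (rule clinear_compose[OF L lin(1)], rule clinear_compose[OF L lin(2)])
  show ?thesis
    by (rule tensor_ext[of "\<lambda>t. L (tensor_lift B t)" "tensor_lift (\<lambda>a b. L (B a b))"])
       (rule clinear_compose[OF L clinear_tensor_lift0], rule clinear_tensor_lift0,
        simp add: tensor_lift_pure B LB)
qed

lemma clinear_tensor_lift_param [lin_intros]:
  assumes "\<And>x. cbilinear (B x)" "\<And>a b. clinear (\<lambda>x. B x a b)"
  shows "clinear (\<lambda>x. tensor_lift (B x) t)"
proof (rule clinearI)
  fix x y c
  have lin: "clinear (\<lambda>b. B x a b)" "clinear (\<lambda>a. B x a b)" for x a b
    using assms(1) by (auto simp: cbilinear_def)
  have bil: "cbilinear (\<lambda>a b. B x a b + B y a b)" "cbilinear (\<lambda>a b. c *\<^sub>C B x a b)"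
    by (intro cbilinearI clinear_plus clinear_scaleC lin)+
  note lifts = clinear_tensor_lift[OF clinear_id]
  show "tensor_lift (B (x + y)) t = tensor_lift (B x) t + tensor_lift (B y) t"
    by (rule tensor_ext[where t = t], rule lifts, rule clinear_plus[OF lifts lifts])
       (simp add: tensor_lift_pure assms(1) bil clinear_add[OF assms(2)])
  show "tensor_lift (B (c *\<^sub>C x)) t = c *\<^sub>C tensor_lift (B x) t"
    by (rule tensor_ext[where t = t], rule lifts, rule clinear_scaleC[OF lifts])
       (simp add: tensor_lift_pure assms(1) bil clinear_scale[OF assms(2)])
qed

definition tensor_map ::
    "('a::complex_vector \<Rightarrow> 'c::complex_vector) \<Rightarrow> ('b::complex_vector \<Rightarrow> 'd::complex_vector) \<Rightarrow>
      ('a, 'b) tensor \<Rightarrow> ('c, 'd) tensor" where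
  "tensor_map f g = tensor_lift (\<lambda>a b. f a \<otimes> g b)"

definition tensor_swap :: "('a::complex_vector, 'b::complex_vector) tensor \<Rightarrow> ('b, 'a) tensor" where
  "tensor_swap = tensor_lift (\<lambda>a b. b \<otimes> a)"

definition tensor_assoc ::
    "(('a::complex_vector, 'b::complex_vector) tensor, 'c::complex_vector) tensor \<Rightarrow> ('a, ('b, 'c) tensor) tensor" where
  "tensor_assoc = tensor_lift (\<lambda>t c. tensor_lift (\<lambda>a b. a \<otimes> (b \<otimes> c)) t)"

instantiation tensor :: (complex_algebra_1, complex_algebra_1) ring
begin

definition times_tensor :: "('a, 'b) tensor \<Rightarrow> ('a, 'b) tensor \<Rightarrow> ('a, 'b) tensor" where
  "s * t = tensor_lift (\<lambda>a b. tensor_lift (\<lambda>c d. (a * c) \<otimes> (b * d)) t) s"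

lemma tensor_times_clinear:
  "clinear (\<lambda>s :: ('a, 'b) tensor. s * t)" "clinear (\<lambda>t :: ('a, 'b) tensor. s * t)"
  unfolding times_tensor_def by (intro lin_intros)+

lemma tensor_times_pure: "(a \<otimes> b) * (c \<otimes> d) = (a * c) \<otimes> (b * d :: 'b)" for a c :: 'a
  unfolding times_tensor_def
  by (subst tensor_lift_pure, (intro lin_intros)+, subst tensor_lift_pure, (intro lin_intros)+) simp

instance
proof
  fix a b c :: "('a, 'b) tensor"
  show "(a + b) * c = a * c + b * c"
    by (rule clinear_add[OF tensor_times_clinear(1)])
  show "a * (b + c) = a * b + a * c"
    by (rule clinear_add[OF tensor_times_clinear(2)])
  note lins = clinear_compose[OF tensor_times_clinear(1)] clinear_compose[OF tensor_times_clinear(2)]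
    tensor_times_clinear
  show "a * b * c = a * (b * c)"
    by (rule tensor_ext[where t = a], (intro lins)+,
        rule tensor_ext[where t = b], (intro lins)+,
        rule tensor_ext[where t = c], (intro lins)+, simp add: tensor_times_pure mult.assoc)
qed

end


section \<open>Coalgebras and convolution algebras\<close>

text \<open>The sort constraint in the next declaration makes \<^class>\<open>complex_vector\<close> a superclass; it cannot
  be listed as one because the type \<open>('a, 'a) tensor\<close> is only formed over that class.\<close>

class complex_coalgebra =
  fixes comult :: "'a::complex_vector \<Rightarrow> ('a, 'a) tensor"
    and counit :: "'a \<Rightarrow> complex"
  assumes clinear_comult: "clinear comult"
    and clinear_counit: "clinear counit"
    and coassoc: "tensor_assoc (tensor_map comult (\<lambda>x. x) (comult a)) = tensor_map (\<lambda>x. x) comult (comult a)"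
    and counit_left: "tensor_lift (\<lambda>x y. counit x *\<^sub>C y) (comult a) = a"
    and counit_right: "tensor_lift (\<lambda>x y. counit y *\<^sub>C x) (comult a) = a"

lemmas clinear_comult' [lin_intros] = clinear_compose[OF clinear_comult]
lemmas clinear_counit' [lin_intros] = clinear_compose[OF clinear_counit]

lemma tensor_lift_exchange:
  assumes "\<And>b c d. clinear (\<lambda>a. G a b c d)" "\<And>a c d. clinear (\<lambda>b. G a b c d)"
    "\<And>a b d. clinear (\<lambda>c. G a b c d)" "\<And>a b c. clinear (\<lambda>d. G a b c d)"
  shows "tensor_lift (\<lambda>a b. tensor_lift (\<lambda>c d. G a b c d) s) t =
         tensor_lift (\<lambda>c d. tensor_lift (\<lambda>a b. G a b c d) t) s"
proof (rule tensor_ext[where t = t])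
  fix a b
  have "tensor_lift (\<lambda>a b. tensor_lift (\<lambda>c d. G a b c d) s) (a \<otimes> b) = tensor_lift (\<lambda>c d. G a b c d) s"
    by (rule tensor_lift_pure) (intro lin_intros assms)
  also have "(\<lambda>c d. G a b c d) = (\<lambda>c d. tensor_lift (\<lambda>a b. G a b c d) (a \<otimes> b))"
    by (intro ext tensor_lift_pure[symmetric] lin_intros assms)
  finally show "tensor_lift (\<lambda>a b. tensor_lift (\<lambda>c d. G a b c d) s) (a \<otimes> b) =
      tensor_lift (\<lambda>c d. tensor_lift (\<lambda>a b. G a b c d) (a \<otimes> b)) s" .
qed (intro lin_intros assms)+

lemma sweedler_coassoc:
  fixes G :: "'a::complex_coalgebra \<Rightarrow> 'a \<Rightarrow> 'a \<Rightarrow> 'b::complex_vector"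
  assumes lin: "\<And>b c. clinear (\<lambda>a. G a b c)" "\<And>a c. clinear (\<lambda>b. G a b c)" "\<And>a b. clinear (\<lambda>c. G a b c)"
  shows "tensor_lift (\<lambda>x c. tensor_lift (\<lambda>a b. G a b c) (comult x)) (comult t) =
         tensor_lift (\<lambda>a x. tensor_lift (\<lambda>b c. G a b c) (comult x)) (comult t)"
proof -
  define W where "W = tensor_lift (\<lambda>a y. tensor_lift (\<lambda>b c. G a b c) y)"
  have W: "clinear (\<lambda>x. W (f x))" if "clinear f" for f :: "'d::complex_vector \<Rightarrow> _"
    unfolding W_def by (intro lin_intros that)
  have Wp: "W (a \<otimes> y) = tensor_lift (\<lambda>b c. G a b c) y" for a y
    unfolding W_def by (rule tensor_lift_pure) (intro lin_intros lin)
  have "W (tensor_map (\<lambda>x. x) comult (comult t)) = tensor_lift (\<lambda>a x. W (a \<otimes> comult x)) (comult t)"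
    unfolding tensor_map_def by (rule clinear_apply_tensor_lift) (intro lin_intros W)+
  moreover have "W (tensor_assoc (tensor_map comult (\<lambda>x. x) (comult t))) =
      tensor_lift (\<lambda>x c. W (tensor_assoc (comult x \<otimes> c))) (comult t)"
    unfolding tensor_map_def
    by (rule clinear_apply_tensor_lift) (unfold tensor_assoc_def, (intro lin_intros W)+)
  moreover have "W (tensor_assoc (comult x \<otimes> c)) = tensor_lift (\<lambda>a b. G a b c) (comult x)" for x c
  proof -
    have "tensor_assoc (comult x \<otimes> c) = tensor_lift (\<lambda>a b. a \<otimes> (b \<otimes> c)) (comult x)"
      unfolding tensor_assoc_def by (rule tensor_lift_pure) (intro lin_intros)
    also have "W \<dots> = tensor_lift (\<lambda>a b. W (a \<otimes> (b \<otimes> c))) (comult x)"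
      by (rule clinear_apply_tensor_lift) (intro lin_intros W)+
    also have "(\<lambda>a b. W (a \<otimes> (b \<otimes> c))) = (\<lambda>a b. G a b c)"
      unfolding Wp by (intro ext tensor_lift_pure lin_intros lin)
    finally show ?thesis .
  qed
  ultimately show ?thesis
    using coassoc[of t] by (simp add: Wp)
qed

instantiation tensor :: (complex_coalgebra, complex_coalgebra) complex_coalgebra
begin

definition comult_tensor :: "('a, 'b) tensor \<Rightarrow> (('a, 'b) tensor, ('a, 'b) tensor) tensor" where
  "comult_tensor = tensor_lift (\<lambda>a b.
     tensor_lift (\<lambda>a\<^sub>1 a\<^sub>2. tensor_lift (\<lambda>b\<^sub>1 b\<^sub>2. (a\<^sub>1 \<otimes> b\<^sub>1) \<otimes> (a\<^sub>2 \<otimes> b\<^sub>2)) (comult b)) (comult a))"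

definition counit_tensor :: "('a, 'b) tensor \<Rightarrow> complex" where
  "counit_tensor = tensor_lift (\<lambda>a b. counit a * counit b)"

lemma lin_comult_tensor: "clinear f \<Longrightarrow> clinear (\<lambda>x. comult (f x :: ('a, 'b) tensor))"
  unfolding comult_tensor_def by (intro lin_intros)

lemma lin_counit_tensor: "clinear f \<Longrightarrow> clinear (\<lambda>x. counit (f x :: ('a, 'b) tensor))"
  unfolding counit_tensor_def by (intro lin_intros)

lemma counit_tensor_pure: "counit (a \<otimes> b :: ('a, 'b) tensor) = counit a * counit b"
  unfolding counit_tensor_def by (rule tensor_lift_pure) (intro lin_intros)

lemma comult_tensor_pure: "comult (a \<otimes> b :: ('a, 'b) tensor) =
    tensor_lift (\<lambda>a\<^sub>1 a\<^sub>2. tensor_lift (\<lambda>b\<^sub>1 b\<^sub>2. (a\<^sub>1 \<otimes> b\<^sub>1) \<otimes> (a\<^sub>2 \<otimes> b\<^sub>2)) (comult b)) (comult a)"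
  unfolding comult_tensor_def by (rule tensor_lift_pure) (intro lin_intros)

lemma sweedler_tensor:
  fixes B :: "('a, 'b) tensor \<Rightarrow> ('a, 'b) tensor \<Rightarrow> 'c::complex_vector"
  assumes "cbilinear B"
  shows "tensor_lift B (comult (a \<otimes> b)) =
    tensor_lift (\<lambda>a\<^sub>1 a\<^sub>2. tensor_lift (\<lambda>b\<^sub>1 b\<^sub>2. B (a\<^sub>1 \<otimes> b\<^sub>1) (a\<^sub>2 \<otimes> b\<^sub>2)) (comult b)) (comult a)"
proof -
  note lift = clinear_apply_tensor_lift[OF clinear_tensor_lift0[of B]]
  have "tensor_lift B (tensor_lift (\<lambda>b\<^sub>1 b\<^sub>2. (a\<^sub>1 \<otimes> b\<^sub>1) \<otimes> (a\<^sub>2 \<otimes> b\<^sub>2)) (comult b)) =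
      tensor_lift (\<lambda>b\<^sub>1 b\<^sub>2. tensor_lift B ((a\<^sub>1 \<otimes> b\<^sub>1) \<otimes> (a\<^sub>2 \<otimes> b\<^sub>2))) (comult b)" for a\<^sub>1 a\<^sub>2
    by (rule lift) (intro lin_intros)
  moreover have "tensor_lift B (comult (a \<otimes> b)) = tensor_lift (\<lambda>a\<^sub>1 a\<^sub>2.
      tensor_lift B (tensor_lift (\<lambda>b\<^sub>1 b\<^sub>2. (a\<^sub>1 \<otimes> b\<^sub>1) \<otimes> (a\<^sub>2 \<otimes> b\<^sub>2)) (comult b))) (comult a)"
    unfolding comult_tensor_pure by (rule lift) (intro lin_intros)
  ultimately show ?thesis
    by (simp add: tensor_lift_pure[OF assms])
qed

instance
proof
  show "clinear (comult :: ('a, 'b) tensor \<Rightarrow> _)" "clinear (counit :: ('a, 'b) tensor \<Rightarrow> _)"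
    using lin_comult_tensor[of "\<lambda>x. x"] lin_counit_tensor[of "\<lambda>x. x"] clinear_id by auto
next
  fix t :: "('a, 'b) tensor"
  show "tensor_lift (\<lambda>x y. counit x *\<^sub>C y) (comult t) = t"
  proof (rule tensor_ext[where t = t])
    fix a :: 'a and b :: 'b
    have "tensor_lift (\<lambda>x y. counit x *\<^sub>C y) (comult (a \<otimes> b)) =
      tensor_lift (\<lambda>a\<^sub>1 a\<^sub>2. tensor_lift (\<lambda>b\<^sub>1 b\<^sub>2. (counit a\<^sub>1 *\<^sub>C a\<^sub>2) \<otimes> (counit b\<^sub>1 *\<^sub>C b\<^sub>2)) (comult b)) (comult a)"
      by (subst sweedler_tensor[of "\<lambda>x y :: ('a, 'b) tensor. counit x *\<^sub>C y"], intro lin_intros lin_counit_tensor)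
         (simp add: counit_tensor_pure mult.commute clinear_scale[OF clinear_pure_left[OF clinear_id]]
           clinear_scale[OF clinear_pure_right[OF clinear_id]])
    also have "\<dots> = tensor_lift (\<lambda>a\<^sub>1 a\<^sub>2. (counit a\<^sub>1 *\<^sub>C a\<^sub>2) \<otimes> b) (comult a)"
    proof -
      have "tensor_lift (\<lambda>b\<^sub>1 b\<^sub>2. u \<otimes> (counit b\<^sub>1 *\<^sub>C b\<^sub>2)) (comult b) = u \<otimes> b" for u :: 'a
        using clinear_apply_tensor_lift[of "\<lambda>x. u \<otimes> x" "\<lambda>b\<^sub>1 b\<^sub>2. counit b\<^sub>1 *\<^sub>C b\<^sub>2" "comult b"]
        by (simp add: counit_left lin_intros)
      then show ?thesis by simp
    qed
    also have "\<dots> = a \<otimes> b"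
      using clinear_apply_tensor_lift[of "\<lambda>x. x \<otimes> b" "\<lambda>a\<^sub>1 a\<^sub>2. counit a\<^sub>1 *\<^sub>C a\<^sub>2" "comult a"]
      by (simp add: counit_left lin_intros)
    finally show "tensor_lift (\<lambda>x y. counit x *\<^sub>C y) (comult (a \<otimes> b)) = a \<otimes> b" .
  qed (intro lin_intros lin_comult_tensor)+
  show "tensor_lift (\<lambda>x y. counit y *\<^sub>C x) (comult t) = t"
  proof (rule tensor_ext[where t = t])
    fix a :: 'a and b :: 'b
    have "tensor_lift (\<lambda>x y. counit y *\<^sub>C x) (comult (a \<otimes> b)) =
      tensor_lift (\<lambda>a\<^sub>1 a\<^sub>2. tensor_lift (\<lambda>b\<^sub>1 b\<^sub>2. (counit a\<^sub>2 *\<^sub>C a\<^sub>1) \<otimes> (counit b\<^sub>2 *\<^sub>C b\<^sub>1)) (comult b)) (comult a)"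
      by (subst sweedler_tensor[of "\<lambda>x y :: ('a, 'b) tensor. counit y *\<^sub>C x"], intro lin_intros lin_counit_tensor)
         (simp add: counit_tensor_pure mult.commute clinear_scale[OF clinear_pure_left[OF clinear_id]]
           clinear_scale[OF clinear_pure_right[OF clinear_id]])
    also have "\<dots> = tensor_lift (\<lambda>a\<^sub>1 a\<^sub>2. (counit a\<^sub>2 *\<^sub>C a\<^sub>1) \<otimes> b) (comult a)"
    proof -
      have "tensor_lift (\<lambda>b\<^sub>1 b\<^sub>2. u \<otimes> (counit b\<^sub>2 *\<^sub>C b\<^sub>1)) (comult b) = u \<otimes> b" for u :: 'a
        using clinear_apply_tensor_lift[of "\<lambda>x. u \<otimes> x" "\<lambda>b\<^sub>1 b\<^sub>2. counit b\<^sub>2 *\<^sub>C b\<^sub>1" "comult b"]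
        by (simp add: counit_right lin_intros)
      then show ?thesis by simp
    qed
    also have "\<dots> = a \<otimes> b"
      using clinear_apply_tensor_lift[of "\<lambda>x. x \<otimes> b" "\<lambda>a\<^sub>1 a\<^sub>2. counit a\<^sub>2 *\<^sub>C a\<^sub>1" "comult a"]
      by (simp add: counit_right lin_intros)
    finally show "tensor_lift (\<lambda>x y. counit y *\<^sub>C x) (comult (a \<otimes> b)) = a \<otimes> b" .
  qed (intro lin_intros lin_comult_tensor)+
  show "tensor_assoc (tensor_map comult (\<lambda>x. x) (comult t)) = tensor_map (\<lambda>x. x) comult (comult t)"
  proof (rule tensor_ext[where t = t])
    fix a :: 'a and b :: 'b
    have assoc_pure: "tensor_assoc (s \<otimes> c) = tensor_lift (\<lambda>a b. a \<otimes> (b \<otimes> c)) s"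
      for s :: "(('a, 'b) tensor, ('a, 'b) tensor) tensor" and c :: "('a, 'b) tensor"
      unfolding tensor_assoc_def by (rule tensor_lift_pure) (intro lin_intros)
    have E0: "tensor_lift (\<lambda>u v. u \<otimes> (v \<otimes> w)) (comult (x \<otimes> y)) =
        tensor_lift (\<lambda>a\<^sub>1 a\<^sub>2. tensor_lift (\<lambda>b\<^sub>1 b\<^sub>2. (a\<^sub>1 \<otimes> b\<^sub>1) \<otimes> (a\<^sub>2 \<otimes> b\<^sub>2) \<otimes> w) (comult y)) (comult x)" for x :: 'a and y :: 'b and w :: "('a, 'b) tensor"
      by (rule sweedler_tensor) (intro lin_intros)+
    have E5: "(a\<^sub>1 \<otimes> b\<^sub>1) \<otimes> comult (x \<otimes> y) = tensor_lift (\<lambda>a\<^sub>2 a\<^sub>3. tensor_lift (\<lambda>b\<^sub>2 b\<^sub>3. (a\<^sub>1 \<otimes> b\<^sub>1) \<otimes> (a\<^sub>2 \<otimes> b\<^sub>2) \<otimes> (a\<^sub>3 \<otimes> b\<^sub>3)) (comult y)) (comult x)"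
      for a\<^sub>1 x :: 'a and b\<^sub>1 y :: 'b
    proof -
      have *: "(a\<^sub>1 \<otimes> b\<^sub>1) \<otimes> tensor_lift (\<lambda>b\<^sub>2 b\<^sub>3. (a\<^sub>2 \<otimes> b\<^sub>2) \<otimes> (a\<^sub>3 \<otimes> b\<^sub>3)) (comult y) = tensor_lift (\<lambda>b\<^sub>2 b\<^sub>3. (a\<^sub>1 \<otimes> b\<^sub>1) \<otimes> (a\<^sub>2 \<otimes> b\<^sub>2) \<otimes> (a\<^sub>3 \<otimes> b\<^sub>3)) (comult y)" for a\<^sub>2 a\<^sub>3
        by (rule clinear_apply_tensor_lift) (intro lin_intros)+
      show ?thesis
        unfolding comult_tensor_pure *[symmetric]
        by (rule clinear_apply_tensor_lift) (intro lin_intros)+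
    qed
    have E1: "tensor_lift (\<lambda>y b\<^sub>3. tensor_lift (\<lambda>a\<^sub>1 a\<^sub>2. tensor_lift (\<lambda>b\<^sub>1 b\<^sub>2. (a\<^sub>1 \<otimes> b\<^sub>1) \<otimes> (a\<^sub>2 \<otimes> b\<^sub>2) \<otimes> (a\<^sub>3 \<otimes> b\<^sub>3)) (comult y)) (comult x)) (comult b) =
        tensor_lift (\<lambda>a\<^sub>1 a\<^sub>2. tensor_lift (\<lambda>y b\<^sub>3. tensor_lift (\<lambda>b\<^sub>1 b\<^sub>2. (a\<^sub>1 \<otimes> b\<^sub>1) \<otimes> (a\<^sub>2 \<otimes> b\<^sub>2) \<otimes> (a\<^sub>3 \<otimes> b\<^sub>3)) (comult y)) (comult b)) (comult x)" for x a\<^sub>3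
      by (rule tensor_lift_exchange) (intro lin_intros)+
    have E2: "tensor_lift (\<lambda>y b\<^sub>3. tensor_lift (\<lambda>b\<^sub>1 b\<^sub>2. (a\<^sub>1 \<otimes> b\<^sub>1) \<otimes> (a\<^sub>2 \<otimes> b\<^sub>2) \<otimes> (a\<^sub>3 \<otimes> b\<^sub>3)) (comult y)) (comult b) =
        tensor_lift (\<lambda>b\<^sub>1 y. tensor_lift (\<lambda>b\<^sub>2 b\<^sub>3. (a\<^sub>1 \<otimes> b\<^sub>1) \<otimes> (a\<^sub>2 \<otimes> b\<^sub>2) \<otimes> (a\<^sub>3 \<otimes> b\<^sub>3)) (comult y)) (comult b)" for a\<^sub>1 a\<^sub>2 a\<^sub>3
      by (rule sweedler_coassoc) (intro lin_intros)+
    have E4: "tensor_lift (\<lambda>a\<^sub>2 a\<^sub>3. tensor_lift (\<lambda>b\<^sub>1 y. tensor_lift (\<lambda>b\<^sub>2 b\<^sub>3. (a\<^sub>1 \<otimes> b\<^sub>1) \<otimes> (a\<^sub>2 \<otimes> b\<^sub>2) \<otimes> (a\<^sub>3 \<otimes> b\<^sub>3)) (comult y)) (comult b)) (comult x) =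
        tensor_lift (\<lambda>b\<^sub>1 y. tensor_lift (\<lambda>a\<^sub>2 a\<^sub>3. tensor_lift (\<lambda>b\<^sub>2 b\<^sub>3. (a\<^sub>1 \<otimes> b\<^sub>1) \<otimes> (a\<^sub>2 \<otimes> b\<^sub>2) \<otimes> (a\<^sub>3 \<otimes> b\<^sub>3)) (comult y)) (comult x)) (comult b)" for x a\<^sub>1
      by (rule tensor_lift_exchange) (intro lin_intros)+
    have "tensor_assoc (tensor_map comult (\<lambda>x. x) (comult (a \<otimes> b))) =
        tensor_lift (\<lambda>x c. tensor_assoc (comult x \<otimes> c)) (comult (a \<otimes> b))"
      unfolding tensor_map_def
      by (rule clinear_apply_tensor_lift)
         (unfold tensor_assoc_def, (intro lin_intros lin_comult_tensor)+)
    also have "\<dots> = tensor_lift (\<lambda>x c. tensor_lift (\<lambda>a b. a \<otimes> (b \<otimes> c)) (comult x)) (comult (a \<otimes> b))"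
      by (simp only: assoc_pure)
    also have "\<dots> = tensor_lift (\<lambda>x a\<^sub>3. tensor_lift (\<lambda>y b\<^sub>3.
        tensor_lift (\<lambda>a\<^sub>1 a\<^sub>2. tensor_lift (\<lambda>b\<^sub>1 b\<^sub>2. (a\<^sub>1 \<otimes> b\<^sub>1) \<otimes> (a\<^sub>2 \<otimes> b\<^sub>2) \<otimes> (a\<^sub>3 \<otimes> b\<^sub>3)) (comult y)) (comult x))
        (comult b)) (comult a)"
      unfolding E0[symmetric]
      by (rule sweedler_tensor) (intro lin_intros lin_comult_tensor)+
    also have "\<dots> = tensor_lift (\<lambda>x a\<^sub>3. tensor_lift (\<lambda>a\<^sub>1 a\<^sub>2. tensor_lift (\<lambda>y b\<^sub>3.
        tensor_lift (\<lambda>b\<^sub>1 b\<^sub>2. (a\<^sub>1 \<otimes> b\<^sub>1) \<otimes> (a\<^sub>2 \<otimes> b\<^sub>2) \<otimes> (a\<^sub>3 \<otimes> b\<^sub>3)) (comult y)) (comult b)) (comult x))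
        (comult a)"
      by (simp only: E1)
    also have "\<dots> = tensor_lift (\<lambda>x a\<^sub>3. tensor_lift (\<lambda>a\<^sub>1 a\<^sub>2. tensor_lift (\<lambda>b\<^sub>1 y.
        tensor_lift (\<lambda>b\<^sub>2 b\<^sub>3. (a\<^sub>1 \<otimes> b\<^sub>1) \<otimes> (a\<^sub>2 \<otimes> b\<^sub>2) \<otimes> (a\<^sub>3 \<otimes> b\<^sub>3)) (comult y)) (comult b)) (comult x))
        (comult a)"
      by (simp only: E2)
    also have "\<dots> = tensor_lift (\<lambda>a\<^sub>1 x. tensor_lift (\<lambda>a\<^sub>2 a\<^sub>3. tensor_lift (\<lambda>b\<^sub>1 y.
        tensor_lift (\<lambda>b\<^sub>2 b\<^sub>3. (a\<^sub>1 \<otimes> b\<^sub>1) \<otimes> (a\<^sub>2 \<otimes> b\<^sub>2) \<otimes> (a\<^sub>3 \<otimes> b\<^sub>3)) (comult y)) (comult b)) (comult x))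
        (comult a)"
      by (rule sweedler_coassoc) (intro lin_intros)+
    also have "\<dots> = tensor_lift (\<lambda>a\<^sub>1 x. tensor_lift (\<lambda>b\<^sub>1 y. tensor_lift (\<lambda>a\<^sub>2 a\<^sub>3.
        tensor_lift (\<lambda>b\<^sub>2 b\<^sub>3. (a\<^sub>1 \<otimes> b\<^sub>1) \<otimes> (a\<^sub>2 \<otimes> b\<^sub>2) \<otimes> (a\<^sub>3 \<otimes> b\<^sub>3)) (comult y)) (comult x)) (comult b))
        (comult a)"
      by (simp only: E4)
    also have "\<dots> = tensor_lift (\<lambda>x y. x \<otimes> comult y) (comult (a \<otimes> b))"
      unfolding E5[symmetric]
      by (rule sweedler_tensor[symmetric]) (intro lin_intros lin_comult_tensor)+
    finally show "tensor_assoc (tensor_map comult (\<lambda>x. x) (comult (a \<otimes> b))) =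
        tensor_map (\<lambda>x. x) comult (comult (a \<otimes> b))"
      by (simp add: tensor_map_def)
  qed (unfold tensor_assoc_def tensor_map_def, (intro lin_intros lin_comult_tensor)+)
qed

end


text \<open>Linear maps from a coalgebra to an algebra, with the convolution product. For a coalgebra \<open>F\<close>,
  \<open>(F, complex) conv\<close> is the full dual algebra \<open>U\<close> of \<open>F\<close>, \<open>(F, F) conv\<close> is the algebra denoted
  \<open>U \<otimes> F\<close>, and \<open>((F, F) tensor, complex) conv\<close> is the (completed) algebra \<open>U \<otimes> U\<close>.\<close>

typedef (overloaded) ('c, 'a) conv = "{X :: 'c::complex_vector \<Rightarrow> 'a::complex_vector. clinear X}"
  morphisms app Conv
  using clinear_zero by blast

setup_lifting type_definition_conv

lemma clinear_app [lin_intros]: "clinear f \<Longrightarrow> clinear (\<lambda>x. app X (f x))"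
  using app[of X] by (auto intro: clinear_compose)

instantiation conv :: (complex_vector, complex_vector) complex_vector
begin

lift_definition zero_conv :: "('a, 'b) conv" is "\<lambda>f. 0"
  by (rule clinear_zero)

lift_definition plus_conv :: "('a, 'b) conv \<Rightarrow> ('a, 'b) conv \<Rightarrow> ('a, 'b) conv" is "\<lambda>X Y f. X f + Y f"
  by (rule clinear_plus)

lift_definition minus_conv :: "('a, 'b) conv \<Rightarrow> ('a, 'b) conv \<Rightarrow> ('a, 'b) conv" is "\<lambda>X Y f. X f - Y f"
  by (rule clinear_minus')

lift_definition uminus_conv :: "('a, 'b) conv \<Rightarrow> ('a, 'b) conv" is "\<lambda>X f. - X f"
  by (rule clinear_uminus)

lift_definition scaleC_conv :: "complex \<Rightarrow> ('a, 'b) conv \<Rightarrow> ('a, 'b) conv" is "\<lambda>c X f. c *\<^sub>C X f"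
  by (rule clinear_scaleC)

instance
  by standard (transfer; auto simp: scaleC_add_right scaleC_add_left)+

end

instantiation conv :: (complex_coalgebra, complex_algebra_1) "{ring, monoid_mult}"
begin

lift_definition one_conv :: "('a, 'b) conv" is "\<lambda>f. counit f *\<^sub>C 1"
  by (intro lin_intros)

lift_definition times_conv :: "('a, 'b) conv \<Rightarrow> ('a, 'b) conv \<Rightarrow> ('a, 'b) conv"
  is "\<lambda>X Y f. tensor_lift (\<lambda>f\<^sub>1 f\<^sub>2. X f\<^sub>1 * Y f\<^sub>2) (comult f)"
  by (rule clinear_tensor_lift[OF clinear_comult])

lemma app_times: "app (X * Y) f = tensor_lift (\<lambda>f\<^sub>1 f\<^sub>2. app X f\<^sub>1 * app Y f\<^sub>2) (comult f)"
  for X Y :: "('a, 'b) conv"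
  by (simp add: times_conv.rep_eq)

lemma conv_eqI: "(\<And>f. app X f = app Y f) \<Longrightarrow> X = Y" for X Y :: "('a, 'b) conv"
  by transfer auto

instance
proof
  fix X Y Z :: "('a, 'b) conv"
  show "X * Y * Z = X * (Y * Z)"
  proof (rule conv_eqI)
    fix f
    have l: "tensor_lift (\<lambda>a b. app X a * app Y b) u * z = tensor_lift (\<lambda>a b. app X a * app Y b * z) u" for u z
      by (rule clinear_apply_tensor_lift[where L = "\<lambda>x. x * z"]) (intro lin_intros)+
    have r: "z * tensor_lift (\<lambda>a b. app Y a * app Z b) u = tensor_lift (\<lambda>a b. z * (app Y a * app Z b)) u" for u z
      by (rule clinear_apply_tensor_lift[where L = "\<lambda>x. z * x"]) (intro lin_intros)+
    have "tensor_lift (\<lambda>x c. tensor_lift (\<lambda>a b. app X a * app Y b * app Z c) (comult x)) (comult f) =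
        tensor_lift (\<lambda>a x. tensor_lift (\<lambda>b c. app X a * app Y b * app Z c) (comult x)) (comult f)"
      by (rule sweedler_coassoc) (intro lin_intros)+
    then show "app (X * Y * Z) f = app (X * (Y * Z)) f"
      by (simp add: app_times l r mult.assoc)
  qed
  have lin: "clinear (\<lambda>x. app W x)" for W :: "('a, 'b) conv"
    by (intro lin_intros)
  show "1 * X = X"
  proof (rule conv_eqI)
    fix f
    show "app (1 * X) f = app X f"
      using clinear_apply_tensor_lift[of "\<lambda>x. app X x" "\<lambda>x y. counit x *\<^sub>C y" "comult f"]
      by (simp add: app_times one_conv.rep_eq counit_left clinear_scale[OF lin] lin_intros)
  qed
  show "X * 1 = X"
  proof (rule conv_eqI)
    fix f
    show "app (X * 1) f = app X f"
      using clinear_apply_tensor_lift[of "\<lambda>x. app X x" "\<lambda>x y. counit y *\<^sub>C x" "comult f"]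
      by (simp add: app_times one_conv.rep_eq counit_right clinear_scale[OF lin] lin_intros)
  qed
  have add: "tensor_lift (\<lambda>a b. B a b + C a b) u = tensor_lift B u + tensor_lift C u"
    if "cbilinear B" "cbilinear C" for B C :: "'a \<Rightarrow> 'a \<Rightarrow> 'b" and u
  proof -
    have lins: "clinear (\<lambda>b. B a b)" "clinear (\<lambda>a. B a b)" "clinear (\<lambda>b. C a b)" "clinear (\<lambda>a. C a b)" for a b
      using that by (auto simp: cbilinear_def)
    have BC: "cbilinear (\<lambda>a b. B a b + C a b)"
      by (intro cbilinearI clinear_plus lins)
    show ?thesis
      by (rule tensor_ext[OF clinear_tensor_lift0 clinear_plus[OF clinear_tensor_lift0 clinear_tensor_lift0]])
         (simp add: tensor_lift_pure that BC)
  qed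
  show "(X + Y) * Z = X * Z + Y * Z" "X * (Y + Z) = X * Y + X * Z"
    by (rule conv_eqI, simp add: app_times plus_conv.rep_eq distrib_right distrib_left,
        rule add; intro lin_intros)+
qed

end

instance conv :: ("{complex_coalgebra, zero_neq_one}", complex_algebra_1) ring_1
proof
  show "(0 :: ('a, 'b) conv) \<noteq> 1"
  proof
    assume "(0 :: ('a, 'b) conv) = 1"
    then have "counit f *\<^sub>C (1 :: 'b) = 0" for f :: 'a
      by transfer metis
    then have "counit f = 0" for f :: 'a
      by (metis complex_vector.scale_eq_0_iff zero_neq_one)
    then have "f = tensor_lift (\<lambda>x y. 0) (comult f)" for f :: 'a
      using counit_left[of f] by simp
    moreover have "tensor_lift (\<lambda>x y. 0 :: 'a) t = 0" for t :: "('a, 'a) tensor"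
      by transfer (simp add: free_lift_def)
    ultimately have "f = 0" for f :: 'a by simp
    from this[of 1] show False by simp
  qed
qed

text \<open>The element \<open>x \<otimes> a\<close> of \<open>U \<otimes> F\<close>, as the linear map \<open>f \<mapsto> \<langle>x, f\<rangle> a\<close>.\<close>

lift_definition elem :: "('c::complex_vector, complex) conv \<Rightarrow> 'a::complex_vector \<Rightarrow> ('c, 'a) conv"
  is "\<lambda>x a f. x f *\<^sub>C a"
  by (rule clinear_scaleC_left)

lift_definition universal_T :: "('f::complex_vector, 'f) conv" is "\<lambda>f. f"
  by (rule clinear_id)


section \<open>Coquasitriangular face Hopf algebras\<close>

abbreviation sweedler :: "'f::complex_coalgebra \<Rightarrow> ('f \<Rightarrow> 'f \<Rightarrow> 'b::complex_vector) \<Rightarrow> 'b" where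
  "sweedler a B \<equiv> tensor_lift B (comult a)"

abbreviation sweedler3 :: "'f::complex_coalgebra \<Rightarrow> ('f \<Rightarrow> 'f \<Rightarrow> 'f \<Rightarrow> 'b::complex_vector) \<Rightarrow> 'b" where
  "sweedler3 a B \<equiv> sweedler a (\<lambda>x a\<^sub>3. sweedler x (\<lambda>a\<^sub>1 a\<^sub>2. B a\<^sub>1 a\<^sub>2 a\<^sub>3))"

text \<open>In the following locale \<open>el i\<close> and \<open>eu i\<close> are the elements \<open>e\<^sub>i\<close> and \<open>e\<^sup>i\<close>.\<close>

locale face_hopf_algebra =
  fixes V :: "'v set"
    and el eu :: "'v \<Rightarrow> 'f::{complex_algebra_1, complex_coalgebra}"
    and S :: "'f \<Rightarrow> 'f"
  assumes finite_V: "finite V"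
    and comult_mult: "comult (a * b) = comult a * comult b"
    and el_el: "i \<in> V \<Longrightarrow> j \<in> V \<Longrightarrow> el i * el j = (if i = j then el i else 0)"
    and eu_eu: "i \<in> V \<Longrightarrow> j \<in> V \<Longrightarrow> eu i * eu j = (if i = j then eu i else 0)"
    and el_eu: "i \<in> V \<Longrightarrow> j \<in> V \<Longrightarrow> el i * eu j = eu j * el i"
    and sum_el: "(\<Sum>i\<in>V. el i) = 1"
    and sum_eu: "(\<Sum>i\<in>V. eu i) = 1"
    and comult_face: "i \<in> V \<Longrightarrow> j \<in> V \<Longrightarrow>
      comult (eu i * el j) = (\<Sum>k\<in>V. (eu i * el k) \<otimes> (eu k * el j))"
    and counit_face: "i \<in> V \<Longrightarrow> j \<in> V \<Longrightarrow> counit (eu i * el j) = (if i = j then 1 else 0)"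
    and counit_mult: "counit (a * b) = (\<Sum>k\<in>V. counit (a * el k) * counit (eu k * b))"
    and clinear_S: "clinear S"
    and S_one: "S 1 = 1"
    and S_mult: "S (a * b) = S b * S a"
    and counit_S: "counit (S a) = counit a"
    and comult_S: "comult (S a) = tensor_swap (tensor_map S S (comult a))"
    and S_left: "sweedler a (\<lambda>a\<^sub>1 a\<^sub>2. S a\<^sub>1 * a\<^sub>2) = (\<Sum>k\<in>V. counit (a * el k) *\<^sub>C el k)"
    and S_right: "sweedler a (\<lambda>a\<^sub>1 a\<^sub>2. a\<^sub>1 * S a\<^sub>2) = (\<Sum>k\<in>V. counit (eu k * a) *\<^sub>C eu k)"
    and S_triple: "sweedler3 a (\<lambda>a\<^sub>1 a\<^sub>2 a\<^sub>3. S a\<^sub>1 * a\<^sub>2 * S a\<^sub>3) = S a"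

text \<open>The coproduct \<open>\<Delta>\<close> of \<open>U\<close> and the opposite coproduct \<open>\<Delta>'\<close>.\<close>

lift_definition coprod_U :: "('f::complex_algebra_1, complex) conv \<Rightarrow> (('f, 'f) tensor, complex) conv"
  is "\<lambda>x t. x (tensor_lift (\<lambda>a b. a * b) t)"
  by (rule clinear_compose[OF _ clinear_tensor_lift0])

lift_definition coprod_U_op :: "('f::complex_algebra_1, complex) conv \<Rightarrow> (('f, 'f) tensor, complex) conv"
  is "\<lambda>x t. x (tensor_lift (\<lambda>a b. b * a) t)"
  by (rule clinear_compose[OF _ clinear_tensor_lift0])

text \<open>\<open>R_tilde S R = (S \<otimes> id)(R)\<close>, for linear \<open>S\<close>.\<close>

lift_definition R_tilde :: "('f::complex_vector \<Rightarrow> 'f) \<Rightarrow> (('f, 'f) tensor, complex) conv \<Rightarrow>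
    (('f, 'f) tensor, complex) conv"
  is "\<lambda>S R t. R (tensor_map S (\<lambda>x. x) t)"
  unfolding tensor_map_def by (rule clinear_compose[OF _ clinear_tensor_lift0])

locale coquasitriangular_face_hopf_algebra = face_hopf_algebra V el eu S
  for V :: "'v set" and el eu :: "'v \<Rightarrow> 'f::{complex_algebra_1, complex_coalgebra}" and S +
  fixes R :: "(('f, 'f) tensor, complex) conv"
  assumes R_exchange:
      "sweedler a (\<lambda>a\<^sub>1 a\<^sub>2. sweedler b (\<lambda>b\<^sub>1 b\<^sub>2. app R (a\<^sub>1 \<otimes> b\<^sub>1) *\<^sub>C (a\<^sub>2 * b\<^sub>2))) =
       sweedler a (\<lambda>a\<^sub>1 a\<^sub>2. sweedler b (\<lambda>b\<^sub>1 b\<^sub>2. app R (a\<^sub>2 \<otimes> b\<^sub>2) *\<^sub>C (b\<^sub>1 * a\<^sub>1)))"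
    and R_tilde_exchange:
      "sweedler a (\<lambda>a\<^sub>1 a\<^sub>2. sweedler b (\<lambda>b\<^sub>1 b\<^sub>2. app (R_tilde S R) (a\<^sub>1 \<otimes> b\<^sub>1) *\<^sub>C (b\<^sub>2 * a\<^sub>2))) =
       sweedler a (\<lambda>a\<^sub>1 a\<^sub>2. sweedler b (\<lambda>b\<^sub>1 b\<^sub>2. app (R_tilde S R) (a\<^sub>2 \<otimes> b\<^sub>2) *\<^sub>C (a\<^sub>1 * b\<^sub>1)))"
    and R_tilde_R: "R_tilde S R * R = coprod_U 1"
    and R_R_tilde: "R * R_tilde S R = coprod_U_op 1"
    and R_coprod: "R = R * coprod_U 1"
    and coprod_op_R: "R = coprod_U_op 1 * R"
    and R_tilde_coprod_op: "R_tilde S R = R_tilde S R * coprod_U_op 1"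
    and coprod_R_tilde: "R_tilde S R = coprod_U 1 * R_tilde S R"
    and R_mult_left: "app R ((a * b) \<otimes> c) = sweedler c (\<lambda>c\<^sub>1 c\<^sub>2. app R (a \<otimes> c\<^sub>1) * app R (b \<otimes> c\<^sub>2))"
    and R_mult_right: "app R (a \<otimes> (b * c)) = sweedler a (\<lambda>a\<^sub>1 a\<^sub>2. app R (a\<^sub>1 \<otimes> c) * app R (a\<^sub>2 \<otimes> b))"

datatype sign = Plus | Minus

text \<open>The maps \<open>R\<^sup>\<plusminus> : F \<rightarrow> U\<close>.\<close>

lift_definition R_plus :: "(('f::complex_vector, 'f) tensor, complex) conv \<Rightarrow> 'f \<Rightarrow> ('f, complex) conv"
  is "\<lambda>R f a. R (f \<otimes> a)"
  by (rule clinear_compose[OF _ clinear_pure_right[OF clinear_id]])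

lift_definition R_minus :: "('f::complex_vector \<Rightarrow> 'f) \<Rightarrow> (('f, 'f) tensor, complex) conv \<Rightarrow> 'f \<Rightarrow> ('f, complex) conv"
  is "\<lambda>S R f a. app (R_tilde S R) (a \<otimes> f)"
  by (intro lin_intros)

fun R_pm :: "('f::complex_vector \<Rightarrow> 'f) \<Rightarrow> (('f, 'f) tensor, complex) conv \<Rightarrow> sign \<Rightarrow> 'f \<Rightarrow> ('f, complex) conv" where
  "R_pm S R Plus f = R_plus R f"
| "R_pm S R Minus f = R_minus S R f"

definition U_pm :: "('f::complex_vector \<Rightarrow> 'f) \<Rightarrow> (('f, 'f) tensor, complex) conv \<Rightarrow> sign \<Rightarrow> ('f, complex) conv set" where
  "U_pm S R s = range (R_pm S R s)"

text \<open>The algebraic (uncompleted) tensor product \<open>U\<^sub>\<plusminus> \<otimes> F\<close> inside \<open>U \<otimes> F\<close>.\<close>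

definition U_pm_F :: "('f::complex_vector \<Rightarrow> 'f) \<Rightarrow> (('f, 'f) tensor, complex) conv \<Rightarrow> sign \<Rightarrow> ('f, 'f) conv set" where
  "U_pm_F S R s = complex_vector.span {elem x a | x a. x \<in> U_pm S R s}"

definition cocommutative :: "'f::complex_coalgebra set" where
  "cocommutative = {f. comult f = tensor_swap (comult f)}"

definition m_pm :: "('f::complex_coalgebra \<Rightarrow> 'f) \<Rightarrow> (('f, 'f) tensor, complex) conv \<Rightarrow> sign \<Rightarrow> 'f \<Rightarrow> ('f, 'f) conv" where
  "m_pm S R s H = sweedler H (\<lambda>h\<^sub>1 h\<^sub>2. elem (R_pm S R s h\<^sub>2) h\<^sub>1)"

definition M_pm :: "('f::{complex_algebra_1, complex_coalgebra} \<Rightarrow> 'f) \<Rightarrow> (('f, 'f) tensor, complex) conv \<Rightarrow>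
    sign \<Rightarrow> 'f \<Rightarrow> ('f, 'f) conv" where
  "M_pm S R s H = elem 1 H - m_pm S R s H"


section \<open>Formal power series in time\<close>

instantiation fps :: (complex_vector) complex_vector
begin

definition scaleC_fps :: "complex \<Rightarrow> 'a fps \<Rightarrow> 'a fps" where
  "c *\<^sub>C X = Abs_fps (\<lambda>n. c *\<^sub>C fps_nth X n)"

instance
  by standard (simp_all add: scaleC_fps_def fps_eq_iff scaleC_add_right scaleC_add_left)

end

text \<open>\<open>exp_t c X\<close> is the formal power series \<open>exp (c t X)\<close> in \<open>t\<close>.\<close>

definition exp_t :: "complex \<Rightarrow> 'a::{complex_vector, monoid_mult} \<Rightarrow> 'a fps" where
  "exp_t c X = Abs_fps (\<lambda>n. (c ^ n / fact n) *\<^sub>C X ^ n)"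

definition evolve :: "'f::{complex_algebra_1, complex_coalgebra} \<Rightarrow> ('f, 'f) conv \<Rightarrow> ('f, 'f) conv fps" where
  "evolve H X = exp_t (- \<i>) (elem 1 H) * fps_const X * exp_t \<i> (elem 1 H)"

definition commutator :: "'a::ring \<Rightarrow> 'a \<Rightarrow> 'a" where
  "commutator X Y = X * Y - Y * X"

text \<open>The Heisenberg and Lax equations for a power series \<open>X(t)\<close> with Hamiltonian \<open>H\<close>; in the Lax
  equation \<open>M\<^sup>\<plusminus>\<close> is the Heisenberg-evolved \<open>M\<^sup>\<plusminus>(t)\<close>.\<close>

definition heisenberg_equation :: "'f::{complex_algebra_1, complex_coalgebra} \<Rightarrow> ('f, 'f) conv fps \<Rightarrow> bool" where
  "heisenberg_equation H X \<longleftrightarrow> \<i> *\<^sub>C fps_deriv X = commutator (fps_const (elem 1 H)) X"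

definition lax_equation :: "('f::{complex_algebra_1, complex_coalgebra} \<Rightarrow> 'f) \<Rightarrow> (('f, 'f) tensor, complex) conv \<Rightarrow>
    sign \<Rightarrow> 'f \<Rightarrow> ('f, 'f) conv fps \<Rightarrow> bool" where
  "lax_equation S R s H X \<longleftrightarrow> \<i> *\<^sub>C fps_deriv X = commutator (evolve H (M_pm S R s H)) X"

definition inverse_pair :: "'a::monoid_mult \<Rightarrow> 'a \<Rightarrow> bool" where
  "inverse_pair x y \<longleftrightarrow> x * y = 1 \<and> y * x = 1"

text \<open>\<open>g\<close> is a solution, with inverses \<open>g'\<close>, of the factorization problem
  \<open>g\<^sub>-\<^sup>-\<^sup>1 g\<^sub>+ = exp (i t (m\<^sub>+ - m\<^sub>-))\<close> with \<open>g\<^sub>\<plusminus> \<in> U\<^sub>\<plusminus> \<otimes> F\<close>.\<close>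

definition factorization :: "('f::{complex_algebra_1, complex_coalgebra} \<Rightarrow> 'f) \<Rightarrow> (('f, 'f) tensor, complex) conv \<Rightarrow>
    'f \<Rightarrow> (sign \<Rightarrow> ('f, 'f) conv fps) \<Rightarrow> (sign \<Rightarrow> ('f, 'f) conv fps) \<Rightarrow> bool" where
  "factorization S R H g g' \<longleftrightarrow>
     (\<forall>s n. fps_nth (g s) n \<in> U_pm_F S R s) \<and>
     (\<forall>s. inverse_pair (g s) (g' s)) \<and>
     g' Minus * g Plus = exp_t \<i> (m_pm S R Plus H - m_pm S R Minus H)"

end

theory Submission
  imports Defs
begin

text \<open>Evaluation at a cocommutative element \<open>t\<close> of a coalgebra is a trace with respect to scalar factors:
  \<open>(x X)(t) = (X x)(t)\<close> when \<open>x\<close> is scalar-valued. Hence in \<open>m(t) = (R_tilde R m)(t) = (R_tilde m\<^sup>o\<^sup>p R)(t)\<close>,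
  with \<open>t = a \<otimes> b\<close> and \<open>m\<close> the multiplication, \<open>R\<close> can be moved back to the left, giving
  \<open>ab = ba\<close>. The same argument, combined with the mixed exchange relation between \<open>R\<^sup>+\<close> and \<open>R\<^sup>-\<close>, shows
  that \<open>m\<^sub>+\<close> and \<open>m\<^sub>-\<close> commute, so that \<open>exp (i t (m\<^sub>+ - m\<^sub>-)) = exp (- i t m\<^sub>-) exp (i t m\<^sub>+)\<close> and the factors
  \<open>g\<^sub>\<plusminus> = exp (- i t (1 \<otimes> H)) exp (i t m\<^sub>\<plusminus>)\<close> solve the factorization problem. The exchange relations say
  directly that \<open>m\<^sub>\<plusminus>\<close> commutes with \<open>T\<close>, which gives the Lax equation. That \<open>1 \<otimes> H\<close> lies in \<open>U\<^sub>\<plusminus> \<otimes> F\<close>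
  rests on \<open>R\<^sup>\<plusminus>(1) = 1\<close>.\<close>

section \<open>Power series over a complex algebra: differential equations with unique
  solutions\<close>

lemma fps_nth_scaleC [simp]: "fps_nth (c *\<^sub>C X) n = c *\<^sub>C fps_nth X n"
  by (simp add: scaleC_fps_def)

lemma of_nat_eq_scaleC: "of_nat n = of_nat n *\<^sub>C (1 :: 'a::complex_algebra_1)"
  by (induction n) (simp_all add: scaleC_add_left)

lemma of_nat_mult_scaleC: "of_nat n * x = of_nat n *\<^sub>C (x :: 'a::complex_algebra_1)"
  by (subst of_nat_eq_scaleC) simp

instance fps :: (complex_algebra_1) complex_algebra_1
  by standard (simp_all add: fps_eq_iff fps_mult_nth complex_vector.scale_sum_right)

lemma fps_const_scaleC: "fps_const (c *\<^sub>C x) = c *\<^sub>C fps_const x"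
  by (simp add: fps_eq_iff)

text \<open>Coefficient n of \<open>F X\<close> depends only on the coefficients of \<open>X\<close>
  up to n, so the equation determines coefficient n + 1: differentiation multiplies it by n + 1, a
  nonzero scalar that can be cancelled.\<close>

lemma fps_ode_unique:
  fixes X Y :: "'a::complex_algebra_1 fps"
  assumes F: "\<And>X Y n. (\<And>k. k \<le> n \<Longrightarrow> fps_nth X k = fps_nth Y k) \<Longrightarrow> fps_nth (F X) n = fps_nth (F Y) n"
    and X: "fps_deriv X = F X" and Y: "fps_deriv Y = F Y"
    and init: "fps_nth X 0 = fps_nth Y 0"
  shows "X = Y"
proof (rule fps_ext)
  fix n show "fps_nth X n = fps_nth Y n"
  proof (induction n rule: less_induct)
    case (less n)
    show ?case
    proof (cases n)
      case (Suc m)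
      have "fps_nth (F X) m = fps_nth (F Y) m"
        by (rule F) (simp add: less.IH Suc)
      then have "of_nat n *\<^sub>C fps_nth X n = of_nat n *\<^sub>C fps_nth Y n"
        unfolding X[symmetric] Y[symmetric] by (simp add: Suc of_nat_mult_scaleC del: of_nat_Suc)
      then show ?thesis
        by (simp add: Suc complex_vector.scale_left_imp_eq del: of_nat_Suc)
    qed (simp add: init)
  qed
qed

lemma fps_linear_ode_unique:
  fixes X Y :: "'a::complex_algebra_1 fps"
  assumes "fps_deriv X = A * X" "fps_deriv Y = A * Y" "fps_nth X 0 = fps_nth Y 0"
  shows "X = Y"
  by (rule fps_ode_unique[where F = "\<lambda>X. A * X"]) (simp_all add: assms fps_mult_nth)

section \<open>Exponential series in t\<close>

lemma exp_t_nth: "fps_nth (exp_t c X) n = (c ^ n / fact n) *\<^sub>C X ^ n"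
  by (simp add: exp_t_def)

lemma exp_t_nth_0 [simp]: "fps_nth (exp_t c X) 0 = 1"
  for X :: "'a::complex_algebra_1"
  by (simp add: exp_t_nth)

lemma exp_t_zero [simp]: "exp_t c 0 = (1 :: 'a::complex_algebra_1 fps)"
  by (simp add: fps_eq_iff exp_t_nth power_0_left)

lemma fps_deriv_exp_t: "fps_deriv (exp_t c X) = c *\<^sub>C (fps_const X * exp_t c X)"
  for X :: "'a::complex_algebra_1"
proof (rule fps_ext)
  fix n
  have "c ^ Suc n / fact (Suc n) * of_nat (Suc n) = c * (c ^ n / fact n)"
    by (simp add: field_simps del: of_nat_Suc)
  then show "fps_nth (fps_deriv (exp_t c X)) n = fps_nth (c *\<^sub>C (fps_const X * exp_t c X)) n"
    by (simp only: fps_deriv_nth fps_nth_scaleC fps_mult_left_const_nth exp_t_nth of_nat_mult_scaleC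
        Suc_eq_plus1[symmetric] scaleC_scaleC mult_scaleC_right power_Suc[of X]
        mult.commute[of "of_nat (Suc n)"])
qed

lemma exp_t_commute:
  fixes X Y :: "'a::complex_algebra_1"
  assumes "X * Y = Y * X"
  shows "exp_t c X * fps_const Y = fps_const Y * exp_t c X"
  by (rule fps_ext) (simp add: exp_t_nth power_commuting_commutes[OF assms])

text \<open>Both sides solve y' = c (X + Y) y with y(0) = 1. Commutation moves \<open>Y\<close> to
  the left of \<open>exp_t c X\<close> in the derivative of the product.\<close>

lemma exp_t_add:
  fixes X Y :: "'a::complex_algebra_1"
  assumes "X * Y = Y * X"
  shows "exp_t c (X + Y) = exp_t c X * exp_t c Y"
proof (rule fps_linear_ode_unique)
  show "fps_deriv (exp_t c (X + Y)) = fps_const (c *\<^sub>C (X + Y)) * exp_t c (X + Y)"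
    by (simp add: fps_deriv_exp_t fps_const_scaleC)
  have "exp_t c X * (fps_const Y * exp_t c Y) = fps_const Y * (exp_t c X * exp_t c Y)"
    by (metis exp_t_commute[OF assms] mult.assoc)
  then show "fps_deriv (exp_t c X * exp_t c Y) = fps_const (c *\<^sub>C (X + Y)) * (exp_t c X * exp_t c Y)"
    by (simp add: fps_deriv_exp_t fps_const_scaleC distrib_right mult.assoc scaleC_add_right
        flip: fps_const_add)
qed (simp add: exp_t_nth)

lemma exp_t_minus: "exp_t (- c) X = exp_t c (- X)" for X :: "'a::complex_algebra_1"
proof (rule fps_ext)
  fix n show "fps_nth (exp_t (- c) X) n = fps_nth (exp_t c (- X)) n"
    by (cases "even n") (simp_all add: exp_t_nth)
qed

lemma exp_t_inverse:
  fixes X :: "'a::complex_algebra_1"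
  shows "exp_t (- c) X * exp_t c X = 1" "exp_t c X * exp_t (- c) X = 1"
  using exp_t_add[of "- X" X c] exp_t_add[of X "- X" c] by (simp_all add: exp_t_minus)

section \<open>Two-sided inverses\<close>

lemma inverse_pairD: "inverse_pair x y \<Longrightarrow> x * y = 1" "inverse_pair x y \<Longrightarrow> y * x = 1"
  by (simp_all add: inverse_pair_def)

lemma inverse_pair_mult:
  assumes "inverse_pair x x'" "inverse_pair y y'"
  shows "inverse_pair (x * y) (y' * x')"
proof -
  have "x * y * (y' * x') = x * (y * y') * x'" "y' * x' * (x * y) = y' * (x' * x) * y"
    by (simp_all only: mult.assoc)
  then show ?thesis
    using assms by (simp add: inverse_pair_def)
qed

lemma inverse_pair_commute: "inverse_pair x y \<Longrightarrow> inverse_pair y x"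
  by (simp add: inverse_pair_def)

lemma inverse_pair_exp_t: "inverse_pair (exp_t c X) (exp_t (- c) X)"
  for X :: "'a::complex_algebra_1"
  by (simp add: inverse_pair_def exp_t_inverse)

section \<open>Heisenberg flow and interaction picture in an arbitrary complex algebra\<close>

text \<open>This is \<open>evolve\<close> with \<open>elem 1 H\<close> replaced by any
  \<open>h\<close> of a complex algebra, which separates the dynamics from the Hopf
  structure.\<close>

definition conj_flow :: "'a::complex_algebra_1 \<Rightarrow> 'a \<Rightarrow> 'a fps" where
  "conj_flow h X = exp_t (- \<i>) h * fps_const X * exp_t \<i> h"

lemma conj_flow_nth_0 [simp]: "fps_nth (conj_flow h X) 0 = X"
  by (simp add: conj_flow_def)

lemma conj_flow_mult: "conj_flow h X * conj_flow h Y = conj_flow h (X * Y)"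
proof -
  have "conj_flow h X * conj_flow h Y =
      exp_t (- \<i>) h * fps_const X * (exp_t \<i> h * exp_t (- \<i>) h) * fps_const Y * exp_t \<i> h"
    by (simp only: conj_flow_def mult.assoc)
  also have "\<dots> = exp_t (- \<i>) h * (fps_const X * fps_const Y) * exp_t \<i> h"
    unfolding exp_t_inverse by (simp only: mult.assoc mult_1_left)
  finally show ?thesis by (simp add: conj_flow_def)
qed

lemma conj_flow_diff: "conj_flow h (X - Y) = conj_flow h X - conj_flow h Y"
  by (simp add: conj_flow_def left_diff_distrib right_diff_distrib flip: fps_const_sub)

lemma conj_flow_self: "conj_flow h h = fps_const h"
  by (simp add: conj_flow_def exp_t_commute exp_t_inverse mult.assoc)

lemma conj_flow_deriv: "\<i> *\<^sub>C fps_deriv (conj_flow h X) = commutator (fps_const h) (conj_flow h X)"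
proof -
  have c: "exp_t \<i> h * fps_const h = fps_const h * exp_t \<i> h"
    by (rule exp_t_commute) simp
  show ?thesis
    by (simp add: conj_flow_def fps_deriv_exp_t commutator_def scaleC_add_right mult.assoc c
        complex_vector.scale_right_diff_distrib)
qed

text \<open>Division by \<open>\<i>\<close> gives X' = F X, where F acts coefficient by coefficient
  because \<open>h\<close> is constant in t.\<close>

lemma conj_flow_unique:
  "fps_nth X 0 = x \<and> \<i> *\<^sub>C fps_deriv X = commutator (fps_const h) X \<longleftrightarrow> X = conj_flow h x"
proof
  assume *: "fps_nth X 0 = x \<and> \<i> *\<^sub>C fps_deriv X = commutator (fps_const h) X"
  have eq: "fps_deriv Y = (- \<i>) *\<^sub>C commutator (fps_const h) Y"
    if "\<i> *\<^sub>C fps_deriv Y = commutator (fps_const h) Y" for Y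
    using arg_cong[OF that, of "scaleC (- \<i>)"] by simp
  show "X = conj_flow h x"
  proof (rule fps_ode_unique[where F = "\<lambda>X. (- \<i>) *\<^sub>C commutator (fps_const h) X"])
    show "fps_deriv X = (- \<i>) *\<^sub>C commutator (fps_const h) X"
      "fps_deriv (conj_flow h x) = (- \<i>) *\<^sub>C commutator (fps_const h) (conj_flow h x)"
      using * conj_flow_deriv by (blast intro: eq)+
  qed (use * in \<open>simp_all add: commutator_def\<close>)
qed (simp add: conj_flow_deriv)

text \<open>The flow is multiplicative and fixes \<open>h\<close>. So the evolved
  \<open>h - m\<close> is \<open>h\<close> minus the evolved \<open>m\<close>, and the latter still
  commutes with the evolved \<open>X\<close>.\<close>

lemma conj_flow_commutator_eq:
  assumes "m * X = X * m"
  shows "commutator (conj_flow h (h - m)) (conj_flow h X) = commutator (fps_const h) (conj_flow h X)"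
proof -
  have "conj_flow h m * conj_flow h X = conj_flow h X * conj_flow h m"
    by (simp add: conj_flow_mult assms)
  then show ?thesis
    by (simp add: commutator_def conj_flow_diff conj_flow_self left_diff_distrib right_diff_distrib)
qed

text \<open>Differentiation produces h - m between the two exponentials; inserting exp(ith)
  exp(-ith) = 1 after it turns it into the evolved element on the far left.\<close>

lemma interaction_flow_deriv:
  "\<i> *\<^sub>C fps_deriv (exp_t (- \<i>) h * exp_t \<i> m) =
    conj_flow h (h - m) * (exp_t (- \<i>) h * exp_t \<i> m)"
proof -
  have "conj_flow h (h - m) * (exp_t (- \<i>) h * exp_t \<i> m) =
      exp_t (- \<i>) h * fps_const (h - m) * (exp_t \<i> h * exp_t (- \<i>) h) * exp_t \<i> m"
    by (simp only: conj_flow_def mult.assoc)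
  also have "\<dots> = exp_t (- \<i>) h * fps_const h * exp_t \<i> m - exp_t (- \<i>) h * fps_const m * exp_t \<i> m"
    by (simp add: exp_t_inverse left_diff_distrib right_diff_distrib mult.assoc flip: fps_const_sub)
  finally show ?thesis
    by (simp add: fps_deriv_exp_t scaleC_add_right exp_t_commute mult.assoc
        complex_vector.scale_right_diff_distrib)
qed

lemma interaction_flow_unique:
  "fps_nth x 0 = 1 \<and> \<i> *\<^sub>C fps_deriv x = conj_flow h (h - m) * x \<longleftrightarrow>
    x = exp_t (- \<i>) h * exp_t \<i> m"
proof
  assume *: "fps_nth x 0 = 1 \<and> \<i> *\<^sub>C fps_deriv x = conj_flow h (h - m) * x"
  have eq: "fps_deriv y = ((- \<i>) *\<^sub>C conj_flow h (h - m)) * y"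
    if "\<i> *\<^sub>C fps_deriv y = conj_flow h (h - m) * y" for y
    using arg_cong[OF that, of "scaleC (- \<i>)"] by simp
  show "x = exp_t (- \<i>) h * exp_t \<i> m"
  proof (rule fps_linear_ode_unique)
    show "fps_deriv x = ((- \<i>) *\<^sub>C conj_flow h (h - m)) * x"
      "fps_deriv (exp_t (- \<i>) h * exp_t \<i> m) =
        ((- \<i>) *\<^sub>C conj_flow h (h - m)) * (exp_t (- \<i>) h * exp_t \<i> m)"
      using * interaction_flow_deriv by (blast intro: eq)+
  qed (use * in simp)
qed (simp add: interaction_flow_deriv del: fps_deriv_mult)

section \<open>Swaps, products and cocommutative elements of tensor products\<close>

lemma tensor_lift_swap:
  assumes "cbilinear B"
  shows "tensor_lift B (tensor_swap t) = tensor_lift (\<lambda>a b. B b a) t"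
proof -
  have lin: "clinear (\<lambda>b. B a b)" "clinear (\<lambda>a. B a b)" for a b
    using assms by (auto simp: cbilinear_def)
  have "tensor_lift B (tensor_swap t) = tensor_lift (\<lambda>a b. tensor_lift B (b \<otimes> a)) t"
    unfolding tensor_swap_def by (rule clinear_apply_tensor_lift) (intro lin_intros)+
  then show ?thesis
    by (simp add: tensor_lift_pure assms)
qed

lemma clinear_tensor_swap [lin_intros]: "clinear f \<Longrightarrow> clinear (\<lambda>x. tensor_swap (f x))"
  unfolding tensor_swap_def by (rule clinear_tensor_lift)

lemma tensor_lift_mult:
  assumes "cbilinear B"
  shows "tensor_lift B (s * t) =
    tensor_lift (\<lambda>a b. tensor_lift (\<lambda>c d. B (a * c) (b * d)) t) s"
proof -
  have lin: "clinear (\<lambda>x. B a (f x))" if "clinear f"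
    for a and f :: "'x::complex_vector \<Rightarrow> _"
    using assms that by (auto simp: cbilinear_def intro: clinear_compose)
  have lin': "clinear (\<lambda>x. B (f x) b)" if "clinear f"
    for b and f :: "'x::complex_vector \<Rightarrow> _"
    using assms that clinear_compose[of "\<lambda>a. B a b" f] by (auto simp: cbilinear_def)
  show ?thesis
    unfolding times_tensor_def
    by (subst clinear_apply_tensor_lift[OF clinear_tensor_lift0], intro lin_intros,
        subst clinear_apply_tensor_lift[OF clinear_tensor_lift0], intro lin_intros)
      (simp add: tensor_lift_pure assms)
qed

lemma tensor_lift_in_span:
  assumes "cbilinear B"
  shows "tensor_lift B t \<in> complex_vector.span {B a b | a b. True}"
proof (induction t rule: tensor_induct)
  case zero
  show ?case by (simp add: clinear_0[OF clinear_tensor_lift0] complex_vector.span_zero)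
next
  case (add a b t)
  show ?case
    unfolding clinear_add[OF clinear_tensor_lift0] tensor_lift_pure[OF assms]
    by (rule complex_vector.span_add[OF complex_vector.span_base add]) blast
qed

lemma cocommutativeD: "a \<in> cocommutative \<Longrightarrow> comult a = tensor_swap (comult a)"
  by (simp add: cocommutative_def)

lemma sweedler_cocommutative:
  assumes "a \<in> cocommutative" "cbilinear B"
  shows "sweedler a B = sweedler a (\<lambda>x y. B y x)"
  by (subst cocommutativeD[OF assms(1)], rule tensor_lift_swap[OF assms(2)])

lemma subspace_cocommutative: "complex_vector.subspace (cocommutative :: 'a::complex_coalgebra set)"
proof -
  have L: "clinear (\<lambda>x :: 'a. comult x - tensor_swap (comult x))"
    by (intro lin_intros)
  have "x \<in> cocommutative \<longleftrightarrow> comult x - tensor_swap (comult x) = 0" for x :: 'a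
    by (simp add: cocommutative_def)
  then show ?thesis
    by (simp only: complex_vector.subspace_def clinear_0[OF L] clinear_add[OF L] clinear_scale[OF L])
      simp
qed

text \<open>Swapping the halves of the coproduct of \<open>a \<otimes> b\<close> exchanges the
  Sweedler legs of both factors at once; each exchange is then undone separately.\<close>

lemma tensor_pure_cocommutative:
  assumes a: "a \<in> cocommutative" and b: "b \<in> cocommutative"
  shows "a \<otimes> b \<in> cocommutative"
proof -
  have "tensor_swap (comult (a \<otimes> b)) =
      sweedler a (\<lambda>a\<^sub>1 a\<^sub>2. sweedler b (\<lambda>b\<^sub>1 b\<^sub>2. (a\<^sub>2 \<otimes> b\<^sub>2) \<otimes> (a\<^sub>1 \<otimes> b\<^sub>1)))"
  proof -
    have lin: "clinear (tensor_swap :: (('a, 'b) tensor, ('a, 'b) tensor) tensor \<Rightarrow> _)"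
      by (rule clinear_tensor_swap[OF clinear_id])
    show ?thesis
      unfolding comult_tensor_pure
      by (subst clinear_apply_tensor_lift[OF lin], intro lin_intros,
          subst clinear_apply_tensor_lift[OF lin], intro lin_intros)
        (simp add: tensor_swap_def tensor_lift_pure lin_intros)
  qed
  also have "\<dots> = sweedler a (\<lambda>a\<^sub>1 a\<^sub>2. sweedler b (\<lambda>b\<^sub>1 b\<^sub>2. (a\<^sub>1 \<otimes> b\<^sub>2) \<otimes> (a\<^sub>2 \<otimes> b\<^sub>1)))"
    by (rule sweedler_cocommutative[OF a]) (intro lin_intros)
  also have "\<dots> = sweedler a (\<lambda>a\<^sub>1 a\<^sub>2. sweedler b (\<lambda>b\<^sub>1 b\<^sub>2. (a\<^sub>1 \<otimes> b\<^sub>1) \<otimes> (a\<^sub>2 \<otimes> b\<^sub>2)))"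
    by (subst sweedler_cocommutative[OF b]) (intro lin_intros refl)+
  finally show ?thesis
    by (simp add: cocommutative_def comult_tensor_pure)
qed

section \<open>Convolution algebras as complex algebras, and their elements
  \<open>x \<otimes> a\<close>\<close>

lemma conv_mult_scaleC:
  fixes X Y :: "('c::complex_coalgebra, 'a::complex_algebra_1) conv"
  shows "(c *\<^sub>C X) * Y = c *\<^sub>C (X * Y)" "X * (c *\<^sub>C Y) = c *\<^sub>C (X * Y)"
proof -
  have "clinear (\<lambda>x :: 'a. c *\<^sub>C x)"
    by (intro lin_intros)
  note lift = clinear_apply_tensor_lift[OF this]
  show "(c *\<^sub>C X) * Y = c *\<^sub>C (X * Y)"
    by (rule conv_eqI, simp add: app_times scaleC_conv.rep_eq, rule lift[symmetric], intro lin_intros)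
  show "X * (c *\<^sub>C Y) = c *\<^sub>C (X * Y)"
    by (rule conv_eqI, simp add: app_times scaleC_conv.rep_eq, rule lift[symmetric], intro lin_intros)
qed

text \<open>Makes the exponentials and flows above available in
  \<open>U \<otimes> F\<close>.\<close>

instance conv :: ("{complex_coalgebra, zero_neq_one}", complex_algebra_1) complex_algebra_1
  by standard (rule conv_mult_scaleC)+

lemma clinear_app_conv [lin_intros]: "clinear f \<Longrightarrow> clinear (\<lambda>x. app (f x) a)"
  by (rule clinearI) (auto simp: clinear_add clinear_scale plus_conv.rep_eq scaleC_conv.rep_eq)

text \<open>Extensionality between arbitrary vector spaces; \<open>conv_eqI\<close> is tied to
  coalgebra and algebra sorts.\<close>

lemma conv_ext: "(\<And>a. app X a = app Y a) \<Longrightarrow> X = Y"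
  by (simp add: app_inject[symmetric] ext)

lemma clinear_elem_left [lin_intros]: "clinear f \<Longrightarrow> clinear (\<lambda>x. elem (f x) a)"
  by (rule clinearI; rule conv_ext)
    (auto simp: clinear_add clinear_scale plus_conv.rep_eq scaleC_conv.rep_eq elem.rep_eq scaleC_add_left)

lemma clinear_elem_right [lin_intros]: "clinear f \<Longrightarrow> clinear (\<lambda>x. elem y (f x))"
  by (rule clinearI; rule conv_ext)
    (auto simp: clinear_add clinear_scale plus_conv.rep_eq scaleC_conv.rep_eq elem.rep_eq
      scaleC_add_right mult.commute)

lemma clinear_conv_mult [lin_intros]:
  fixes Y :: "('c::complex_coalgebra, 'a::complex_algebra_1) conv"
  shows "clinear f \<Longrightarrow> clinear (\<lambda>x. f x * Y)" "clinear f \<Longrightarrow> clinear (\<lambda>x. Y * f x)"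
  by (rule clinearI, auto simp: clinear_add clinear_scale conv_mult_scaleC distrib_left distrib_right)+

lemma elem_one: "elem 1 1 = 1"
  by (rule conv_eqI) (simp add: elem.rep_eq one_conv.rep_eq)

lemma elem_mult:
  fixes x y :: "('c::complex_coalgebra, complex) conv" and a b :: "'a::complex_algebra_1"
  shows "elem x a * elem y b = elem (x * y) (a * b)"
proof (rule conv_eqI)
  fix f
  have "clinear (\<lambda>c. c *\<^sub>C (a * b))"
    by (intro lin_intros)
  from clinear_apply_tensor_lift[OF this, of "\<lambda>f\<^sub>1 f\<^sub>2. app x f\<^sub>1 * app y f\<^sub>2" "comult f"]
  show "app (elem x a * elem y b) f = app (elem (x * y) (a * b)) f"
    by (simp add: app_times elem.rep_eq lin_intros mult.commute)
qed

text \<open>Values of \<open>elem x 1\<close> are scalars and commute with those of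
  \<open>X\<close>, so the two sides differ only in which Sweedler leg of \<open>t\<close> each
  factor receives.\<close>

lemma elem_scalar_trace:
  fixes X :: "('c::complex_coalgebra, 'a::complex_algebra_1) conv"
  assumes "t \<in> cocommutative"
  shows "app (elem x 1 * X) t = app (X * elem x 1) t"
  unfolding app_times elem.rep_eq
  by (subst sweedler_cocommutative[OF assms], intro lin_intros) simp

section \<open>Convolution on the tensor square and the coproduct of U\<close>

lift_definition conv_lift ::
    "('a::complex_vector \<Rightarrow> 'b::complex_vector \<Rightarrow> 'c::complex_vector) \<Rightarrow> (('a, 'b) tensor, 'c) conv"
  is tensor_lift
  by (rule clinear_tensor_lift0)

lemma app_conv_lift_pure: "cbilinear B \<Longrightarrow> app (conv_lift B) (a \<otimes> b) = B a b"
  by (simp add: conv_lift.rep_eq tensor_lift_pure)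

lemma conv_tensor_eqI:
  assumes "\<And>a b. app X (a \<otimes> b) = app Y (a \<otimes> b)"
  shows "X = Y"
proof -
  have "app X t = app Y t" for t
    by (rule tensor_ext[where L = "app X" and M = "app Y"]) (use app[of X] app[of Y] assms in auto)
  then show ?thesis by (rule conv_ext)
qed

lemma app_times_pure:
  fixes X Y :: "(('a::complex_coalgebra, 'b::complex_coalgebra) tensor, 'c::complex_algebra_1) conv"
  shows "app (X * Y) (a \<otimes> b) =
    sweedler a (\<lambda>a\<^sub>1 a\<^sub>2. sweedler b (\<lambda>b\<^sub>1 b\<^sub>2. app X (a\<^sub>1 \<otimes> b\<^sub>1) * app Y (a\<^sub>2 \<otimes> b\<^sub>2)))"
  unfolding app_times by (rule sweedler_tensor) (intro lin_intros)

text \<open>The coproduct of \<open>U\<close> and its opposite, for maps with values in an arbitrary space.\<close>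

definition pull_mult :: "('f::complex_algebra_1, 'a::complex_vector) conv \<Rightarrow> (('f, 'f) tensor, 'a) conv" where
  "pull_mult X = conv_lift (\<lambda>a b. app X (a * b))"

definition pull_mult_op :: "('f::complex_algebra_1, 'a::complex_vector) conv \<Rightarrow> (('f, 'f) tensor, 'a) conv" where
  "pull_mult_op X = conv_lift (\<lambda>a b. app X (b * a))"

lemma app_pull_mult: "app (pull_mult X) (a \<otimes> b) = app X (a * b)"
  unfolding pull_mult_def by (rule app_conv_lift_pure) (intro lin_intros)

lemma app_pull_mult_op: "app (pull_mult_op X) (a \<otimes> b) = app X (b * a)"
  unfolding pull_mult_op_def by (rule app_conv_lift_pure) (intro lin_intros)

lemma app_coprod_U: "app (coprod_U X) (a \<otimes> b) = app X (a * b)"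
  by (simp add: coprod_U.rep_eq tensor_lift_pure lin_intros)

lemma app_coprod_U_op: "app (coprod_U_op X) (a \<otimes> b) = app X (b * a)"
  by (simp add: coprod_U_op.rep_eq tensor_lift_pure lin_intros)

lemma elem_coprod_U: "elem (coprod_U 1) 1 = pull_mult 1"
  by (rule conv_tensor_eqI) (simp add: elem.rep_eq app_coprod_U app_pull_mult one_conv.rep_eq)

lemma elem_coprod_U_op: "elem (coprod_U_op 1) 1 = pull_mult_op 1"
  by (rule conv_tensor_eqI) (simp add: elem.rep_eq app_coprod_U_op app_pull_mult_op one_conv.rep_eq)

lemma clinear_apply_tensor_lift2:
  assumes L: "clinear L"
    and lin: "\<And>y z w. clinear (\<lambda>x. B x y z w)" "\<And>x z w. clinear (\<lambda>y. B x y z w)"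
      "\<And>x y w. clinear (\<lambda>z. B x y z w)" "\<And>x y z. clinear (\<lambda>w. B x y z w)"
  shows "L (tensor_lift (\<lambda>a b. tensor_lift (\<lambda>c d. B a b c d) s) t) =
    tensor_lift (\<lambda>a b. tensor_lift (\<lambda>c d. L (B a b c d)) s) t"
  by (subst clinear_apply_tensor_lift[OF L], intro lin_intros lin,
      subst clinear_apply_tensor_lift[OF L], intro lin_intros lin) (rule refl)

section \<open>Consequences of the face Hopf algebra axioms\<close>

context face_hopf_algebra
begin

lemma sweedler_mult:
  fixes a b :: 'f
  assumes "cbilinear B"
  shows "sweedler (a * b) B = sweedler a (\<lambda>a\<^sub>1 a\<^sub>2. sweedler b (\<lambda>b\<^sub>1 b\<^sub>2. B (a\<^sub>1 * b\<^sub>1) (a\<^sub>2 * b\<^sub>2)))"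
  unfolding comult_mult by (rule tensor_lift_mult[OF assms])

text \<open>Dual to \<open>comult_mult\<close>. With one factor 1 it shows that
  \<open>pull_mult 1\<close> acts as a unit on all \<open>pull_mult X\<close>, although in general
  it is not the unit of the convolution algebra.\<close>

lemma pull_mult_times:
  fixes X Y :: "('f, 'a::complex_algebra_1) conv"
  shows "pull_mult (X * Y) = pull_mult X * pull_mult Y"
proof (rule conv_tensor_eqI)
  fix a b
  show "app (pull_mult (X * Y)) (a \<otimes> b) = app (pull_mult X * pull_mult Y) (a \<otimes> b)"
    by (unfold app_times_pure app_pull_mult, unfold app_times, rule sweedler_mult) (intro lin_intros)
qed

lemma pull_mult_op_times:
  fixes X Y :: "('f, 'a::complex_algebra_1) conv"
  shows "pull_mult_op (X * Y) = pull_mult_op X * pull_mult_op Y"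
proof (rule conv_tensor_eqI)
  fix a b
  have "app (pull_mult_op (X * Y)) (a \<otimes> b) =
      sweedler b (\<lambda>b\<^sub>1 b\<^sub>2. sweedler a (\<lambda>a\<^sub>1 a\<^sub>2. app X (b\<^sub>1 * a\<^sub>1) * app Y (b\<^sub>2 * a\<^sub>2)))"
    unfolding app_pull_mult_op app_times by (rule sweedler_mult) (intro lin_intros)
  also have "\<dots> = app (pull_mult_op X * pull_mult_op Y) (a \<otimes> b)"
    unfolding app_times_pure app_pull_mult_op by (rule tensor_lift_exchange) (intro lin_intros)+
  finally show "app (pull_mult_op (X * Y)) (a \<otimes> b) = app (pull_mult_op X * pull_mult_op Y) (a \<otimes> b)" .
qed

lemma mult_cocommutative:
  assumes a: "a \<in> cocommutative" and b: "b \<in> cocommutative"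
  shows "a * b \<in> (cocommutative :: 'f set)"
proof -
  have pure: "tensor_lift (\<lambda>x y. x \<otimes> y) t = t" for t :: "('f, 'f) tensor"
    by (rule tensor_ext[where t = t]) (intro lin_intros, intro lin_intros, simp add: tensor_lift_pure lin_intros)
  have "tensor_swap (comult (a * b)) = sweedler (a * b) (\<lambda>x y. y \<otimes> x)"
    by (simp add: tensor_swap_def)
  also have "\<dots> = sweedler a (\<lambda>a\<^sub>1 a\<^sub>2. sweedler b (\<lambda>b\<^sub>1 b\<^sub>2. (a\<^sub>2 * b\<^sub>2) \<otimes> (a\<^sub>1 * b\<^sub>1)))"
    by (rule sweedler_mult) (intro lin_intros)
  also have "\<dots> = sweedler a (\<lambda>a\<^sub>1 a\<^sub>2. sweedler b (\<lambda>b\<^sub>1 b\<^sub>2. (a\<^sub>1 * b\<^sub>2) \<otimes> (a\<^sub>2 * b\<^sub>1)))"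
    by (rule sweedler_cocommutative[OF a]) (intro lin_intros)
  also have "\<dots> = sweedler a (\<lambda>a\<^sub>1 a\<^sub>2. sweedler b (\<lambda>b\<^sub>1 b\<^sub>2. (a\<^sub>1 * b\<^sub>1) \<otimes> (a\<^sub>2 * b\<^sub>2)))"
    by (subst sweedler_cocommutative[OF b]) (intro lin_intros refl)+
  also have "\<dots> = sweedler (a * b) (\<lambda>x y. x \<otimes> y)"
    by (rule sweedler_mult[symmetric]) (intro lin_intros)
  finally show ?thesis
    by (simp add: cocommutative_def pure)
qed

lemmas clinear_S' = clinear_compose[OF clinear_S]

lemma counit_el: "k \<in> V \<Longrightarrow> counit (el k) = 1"
proof -
  assume k: "k \<in> V"
  have "counit (el k) = counit ((\<Sum>i\<in>V. eu i) * el k)"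
    by (simp add: sum_eu)
  also have "\<dots> = (\<Sum>i\<in>V. counit (eu i * el k))"
    by (simp add: sum_distrib_right module_hom.sum[OF clinear_module_hom[OF clinear_counit]])
  also have "\<dots> = 1"
    using k finite_V by (simp add: counit_face)
  finally show ?thesis .
qed

lemma sweedler_S:
  assumes "cbilinear B"
  shows "sweedler (S a) B = sweedler a (\<lambda>a\<^sub>1 a\<^sub>2. B (S a\<^sub>2) (S a\<^sub>1))"
proof -
  have lin: "clinear (\<lambda>y. B x y)" "clinear (\<lambda>x. B x y)" for x y
    using assms by (auto simp: cbilinear_def)
  have "sweedler (S a) B = tensor_lift (\<lambda>x y. B y x) (tensor_map S S (comult a))"
    unfolding comult_S by (rule tensor_lift_swap[OF assms])
  also have "\<dots> = sweedler a (\<lambda>a\<^sub>1 a\<^sub>2. tensor_lift (\<lambda>x y. B y x) (S a\<^sub>1 \<otimes> S a\<^sub>2))"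
    unfolding tensor_map_def
    by (rule clinear_apply_tensor_lift[OF clinear_tensor_lift0]) (intro lin_intros clinear_S)
  finally show ?thesis
    by (simp add: tensor_lift_pure cbilinearI lin)
qed

lemma app_R_tilde: "app (R_tilde S R) (a \<otimes> b) = app R (S a \<otimes> b)"
  unfolding R_tilde.rep_eq tensor_map_def
  by (subst tensor_lift_pure) (intro lin_intros clinear_S refl)+

end

section \<open>Linearity of the maps \<open>R\<^sup>+\<close> and \<open>R\<^sup>-\<close>\<close>

lemma clinear_R_plus [lin_intros]: "clinear f \<Longrightarrow> clinear (\<lambda>x. R_plus R (f x))"
  by (rule clinearI; rule conv_ext)
    (auto simp: R_plus.rep_eq clinear_add clinear_scale plus_conv.rep_eq scaleC_conv.rep_eq
      clinear_add[OF clinear_app[OF clinear_pure_left[OF clinear_id]]]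
      clinear_scale[OF clinear_app[OF clinear_pure_left[OF clinear_id]]])

lemma clinear_R_minus [lin_intros]: "clinear f \<Longrightarrow> clinear (\<lambda>x. R_minus S R (f x))"
  by (rule clinearI; rule conv_ext)
    (auto simp: R_minus.rep_eq clinear_add clinear_scale plus_conv.rep_eq scaleC_conv.rep_eq
      clinear_add[OF clinear_app[OF clinear_pure_right[OF clinear_id]]]
      clinear_scale[OF clinear_app[OF clinear_pure_right[OF clinear_id]]])

lemma clinear_R_pm [lin_intros]: "clinear f \<Longrightarrow> clinear (\<lambda>x. R_pm S R s (f x))"
  by (cases s) (simp_all add: clinear_R_plus clinear_R_minus)

lemma app_tensor_lift:
  assumes "cbilinear B"
  shows "app (tensor_lift B t) f = tensor_lift (\<lambda>a b. app (B a b) f) t"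
  by (rule clinear_apply_tensor_lift[OF _ assms]) (intro lin_intros)

lemma tensor_lift_scaleC_right:
  assumes "cbilinear B"
  shows "c *\<^sub>C tensor_lift B t = tensor_lift (\<lambda>a b. c *\<^sub>C B a b) t"
  by (rule clinear_apply_tensor_lift[OF _ assms]) (intro lin_intros)

section \<open>Exchange relations and commutativity of cocommutative elements\<close>

context coquasitriangular_face_hopf_algebra
begin

text \<open>For \<open>X = universal_T\<close> these are the exchange axioms; applying the linear
  map \<open>app X\<close> under the Sweedler sums gives the general case.\<close>

lemma R_scalar_exchange:
  fixes X :: "('f, 'a::complex_algebra_1) conv"
  shows "elem R 1 * pull_mult X = pull_mult_op X * elem R 1"
    and "elem (R_tilde S R) 1 * pull_mult_op X = pull_mult X * elem (R_tilde S R) 1"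
proof -
  have lin: "clinear (app X)"
    using app[of X] by simp
  note push = clinear_apply_tensor_lift2[OF lin, symmetric]
  have scale: "c *\<^sub>C app X y = app X (c *\<^sub>C y)" for c y
    by (rule clinear_scale[OF lin, symmetric])
  show "elem R 1 * pull_mult X = pull_mult_op X * elem R 1"
    by (rule conv_tensor_eqI, simp add: app_times_pure elem.rep_eq app_pull_mult app_pull_mult_op scale,
        subst push, (intro lin_intros)+, subst push, (intro lin_intros)+, simp only: R_exchange)
  show "elem (R_tilde S R) 1 * pull_mult_op X = pull_mult X * elem (R_tilde S R) 1"
    by (rule conv_tensor_eqI, simp add: app_times_pure elem.rep_eq app_pull_mult app_pull_mult_op scale,
        subst push, (intro lin_intros)+, subst push, (intro lin_intros)+, simp only: R_tilde_exchange)
qed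

text \<open>Cocommutativity makes evaluation at \<open>t\<close> a trace as far as scalar factors are concerned, so
  \<open>R\<close> can be moved cyclically to the other side of \<open>R_tilde S R\<close>.\<close>

lemma pull_mult_trace_exchange:
  fixes X :: "('f, 'a::complex_algebra_1) conv"
  assumes t: "t \<in> cocommutative"
    and Z: "Z * elem (R_tilde S R) 1 = elem (R_tilde S R) 1 * Z'"
  shows "app (Z * pull_mult X) t = app (Z' * pull_mult_op X) t"
proof -
  let ?r = "elem R 1" and ?r' = "elem (R_tilde S R) 1"
  have r'r: "?r' * ?r = pull_mult 1" and rr': "?r * ?r' = (pull_mult_op 1 :: (_, 'a) conv)"
    by (simp_all add: elem_mult R_tilde_R R_R_tilde elem_coprod_U elem_coprod_U_op)
  have "Z * pull_mult X = Z * (?r' * ?r * pull_mult X)"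
    unfolding r'r by (simp flip: pull_mult_times)
  also have "\<dots> = Z * ?r' * (?r * pull_mult X)"
    by (simp only: mult.assoc)
  also have "\<dots> = ?r' * Z' * pull_mult_op X * ?r"
    unfolding Z R_scalar_exchange by (simp only: mult.assoc)
  finally have "app (Z * pull_mult X) t = app (?r * (?r' * Z' * pull_mult_op X)) t"
    by (simp add: elem_scalar_trace[OF t])
  also have "?r * (?r' * Z' * pull_mult_op X) = pull_mult_op 1 * (Z' * pull_mult_op X)"
    unfolding rr'[symmetric] by (simp only: mult.assoc)
  \<comment> \<open>\<open>pull_mult_op 1\<close> is absorbed by \<open>pull_mult_op X\<close> only
    when adjacent to it; a second cyclic move carries it past \<open>Z'\<close>.\<close>
  also have "app \<dots> t = app (Z' * pull_mult_op X * pull_mult_op 1) t"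
    unfolding elem_coprod_U_op[symmetric] by (rule elem_scalar_trace[OF t])
  also have "Z' * pull_mult_op X * pull_mult_op 1 = Z' * pull_mult_op X"
    by (simp add: mult.assoc flip: pull_mult_op_times)
  finally show ?thesis .
qed

lemma commute_cocommutative:
  fixes a b :: 'f
  assumes "a \<in> cocommutative" "b \<in> cocommutative"
  shows "a * b = b * a"
proof -
  have "app (1 * pull_mult universal_T) (a \<otimes> b) = app (1 * pull_mult_op universal_T) (a \<otimes> b)"
    by (rule pull_mult_trace_exchange) (simp_all add: tensor_pure_cocommutative assms)
  then show ?thesis
    by (simp add: app_pull_mult app_pull_mult_op universal_T.rep_eq)
qed

section \<open>The maps \<open>R\<^sup>+\<close> and \<open>R\<^sup>-\<close> are unital algebra
  homomorphisms\<close>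

text \<open>Evaluate \<open>R_tilde_R\<close> at \<open>1 \<otimes> b\<close>:
  \<open>R_mult_left\<close> gathers the first arguments into the antipode sum of 1.\<close>

lemma R_plus_one: "R_plus R 1 = 1"
proof (rule conv_eqI)
  fix b
  have L: "clinear (\<lambda>x. app R (x \<otimes> b))"
    by (intro lin_intros)
  have "counit b = app (R_tilde S R * R) (1 \<otimes> b)"
    by (simp add: R_tilde_R app_coprod_U one_conv.rep_eq)
  also have "\<dots> = sweedler 1 (\<lambda>a\<^sub>1 a\<^sub>2. app R ((S a\<^sub>1 * a\<^sub>2) \<otimes> b))"
    by (simp add: app_times_pure app_R_tilde R_mult_left)
  also have "\<dots> = app R (sweedler 1 (\<lambda>a\<^sub>1 a\<^sub>2. S a\<^sub>1 * a\<^sub>2) \<otimes> b)"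
    by (rule clinear_apply_tensor_lift[OF L, symmetric]) (intro lin_intros clinear_S')
  \<comment> \<open>By \<open>S_left\<close> this is the sum of the \<open>el k\<close> weighted by
    \<open>counit (el k) = 1\<close>.\<close>
  also have "sweedler 1 (\<lambda>a\<^sub>1 a\<^sub>2. S a\<^sub>1 * a\<^sub>2) = 1"
    unfolding S_left by (simp add: counit_el sum_el)
  finally show "app (R_plus R 1) b = app 1 b"
    by (simp add: R_plus.rep_eq one_conv.rep_eq)
qed

lemma R_plus_mult: "R_plus R (a * b) = R_plus R a * R_plus R b"
  by (rule conv_eqI) (simp add: R_plus.rep_eq app_times R_mult_left)

text \<open>Two reversals cancel: \<open>R_mult_right\<close> reverses the order of the product, and
  the antipode reverses the Sweedler legs.\<close>

lemma R_minus_mult: "R_minus S R (a * b) = R_minus S R a * R_minus S R b"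
proof (rule conv_eqI)
  fix f
  have "app (R_minus S R (a * b)) f = sweedler (S f) (\<lambda>x y. app R (x \<otimes> b) * app R (y \<otimes> a))"
    by (simp add: R_minus.rep_eq app_R_tilde R_mult_right)
  also have "\<dots> = sweedler f (\<lambda>x y. app R (S y \<otimes> b) * app R (S x \<otimes> a))"
    by (rule sweedler_S) (intro lin_intros)
  finally show "app (R_minus S R (a * b)) f = app (R_minus S R a * R_minus S R b) f"
    by (simp add: app_times R_minus.rep_eq app_R_tilde mult.commute)
qed

text \<open>The functional \<open>R(- \<otimes> 1)\<close> is the unit of \<open>U\<close>: it fixes from the right the second factors of
  \<open>\<Sum> R_tilde(- \<otimes> 1\<^sub>1) R(- \<otimes> 1\<^sub>2) = 1\<close>.\<close>

lemma R_pure_one: "app R (a \<otimes> 1) = counit a"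
proof -
  \<comment> \<open>\<open>Q\<close> is \<open>R_minus\<close> without the antipode, hence an
    antihomomorphism; in particular \<open>Q y * Q 1 = Q y\<close>.\<close>
  define Q where "Q b = Conv (\<lambda>a. app R (a \<otimes> b))" for b
  have app_Q: "app (Q b) a = app R (a \<otimes> b)" for a b
    unfolding Q_def by (subst Conv_inverse) (auto intro!: lin_intros)
  have clinear_Q: "clinear Q"
    by (rule clinearI; rule conv_ext)
      (auto simp: app_Q plus_conv.rep_eq scaleC_conv.rep_eq
        clinear_add[OF clinear_app[OF clinear_pure_right[OF clinear_id]]]
        clinear_scale[OF clinear_app[OF clinear_pure_right[OF clinear_id]]])
  note lin = clinear_compose[OF clinear_Q]
  have Q_mult: "Q b * Q c = Q (c * b)" for b c
    by (rule conv_eqI) (simp add: app_Q app_times R_mult_right)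
  \<comment> \<open>This is \<open>R_tilde_R\<close> at \<open>a \<otimes> 1\<close>. The Sweedler
    sum over 1 remains because the coproduct of 1 is in general not
    \<open>1 \<otimes> 1\<close>.\<close>
  have one: "1 = sweedler 1 (\<lambda>x y. R_minus S R x * Q y)"
  proof (rule conv_eqI)
    fix a
    have "counit a = app (R_tilde S R * R) (a \<otimes> 1)"
      by (simp add: R_tilde_R app_coprod_U one_conv.rep_eq)
    also have "\<dots> = sweedler 1 (\<lambda>x y. sweedler a (\<lambda>a\<^sub>1 a\<^sub>2. app (R_tilde S R) (a\<^sub>1 \<otimes> x) * app R (a\<^sub>2 \<otimes> y)))"
      unfolding app_times_pure by (rule tensor_lift_exchange) (intro lin_intros)+
    also have "\<dots> = app (sweedler 1 (\<lambda>x y. R_minus S R x * Q y)) a"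
      by (subst app_tensor_lift) (intro lin_intros lin, simp add: app_times R_minus.rep_eq app_Q)
    finally show "app 1 a = app (sweedler 1 (\<lambda>x y. R_minus S R x * Q y)) a"
      by (simp add: one_conv.rep_eq)
  qed
  have L: "clinear (\<lambda>X. X * Q 1)"
    by (intro lin_intros)
  have "sweedler 1 (\<lambda>x y. R_minus S R x * Q y) * Q 1 = sweedler 1 (\<lambda>x y. R_minus S R x * Q y * Q 1)"
    by (rule clinear_apply_tensor_lift[OF L]) (intro lin_intros lin)
  also have "\<dots> = sweedler 1 (\<lambda>x y. R_minus S R x * Q y)"
    by (simp add: mult.assoc Q_mult)
  finally have "Q 1 = 1"
    by (simp flip: one)
  then show ?thesis
    by (metis app_Q one_conv.rep_eq mult.right_neutral scaleC_complex_def)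
qed

lemma R_minus_one: "R_minus S R 1 = 1"
  by (rule conv_eqI) (simp add: R_minus.rep_eq app_R_tilde R_pure_one counit_S one_conv.rep_eq)

lemma R_pm_one: "R_pm S R s 1 = 1"
  by (cases s) (simp_all add: R_plus_one R_minus_one)

lemma R_pm_mult: "R_pm S R s (a * b) = R_pm S R s a * R_pm S R s b"
  by (cases s) (simp_all add: R_plus_mult R_minus_mult)

section \<open>Closure properties of \<open>U\<^sub>\<plusminus> \<otimes> F\<close>\<close>

lemma elem_mem_U_pm_F: "elem (R_pm S R s x) a \<in> U_pm_F S R s"
  unfolding U_pm_F_def U_pm_def by (rule complex_vector.span_base) blast

lemma elem_one_mem_U_pm_F: "elem 1 a \<in> U_pm_F S R s"
  using elem_mem_U_pm_F[of s 1 a] by (simp add: R_pm_one)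

lemma subspace_U_pm_F: "complex_vector.subspace (U_pm_F S R s)"
  unfolding U_pm_F_def by (rule complex_vector.subspace_span)

lemma mult_mem_U_pm_F:
  assumes "X \<in> U_pm_F S R s" "Y \<in> U_pm_F S R s"
  shows "X * Y \<in> U_pm_F S R s"
proof -
  note sub = complex_vector.subspace_0[OF subspace_U_pm_F] complex_vector.subspace_add[OF subspace_U_pm_F]
    complex_vector.subspace_scale[OF subspace_U_pm_F]
  have el: "x * y \<in> U_pm_F S R s"
    if "x \<in> {elem x a | x a. x \<in> U_pm S R s}" "y \<in> {elem x a | x a. x \<in> U_pm S R s}" for x y
    using that by (auto simp: U_pm_def elem_mult simp flip: R_pm_mult intro: elem_mem_U_pm_F)
  have el2: "x * Y \<in> U_pm_F S R s" if x: "x \<in> {elem x a | x a. x \<in> U_pm S R s}" for x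
    using assms(2)[unfolded U_pm_F_def]
    by (induction rule: complex_vector.span_induct_alt)
      (auto simp: distrib_left conv_mult_scaleC intro!: sub el x)
  show ?thesis
    using assms(1)[unfolded U_pm_F_def]
    by (induction rule: complex_vector.span_induct_alt)
      (auto simp: distrib_right conv_mult_scaleC intro!: sub el2)
qed

lemma power_mem_U_pm_F: "X \<in> U_pm_F S R s \<Longrightarrow> X ^ n \<in> U_pm_F S R s"
  using elem_one_mem_U_pm_F[of 1 s] by (induction n) (simp_all add: elem_one mult_mem_U_pm_F)

lemma fps_mult_mem_U_pm_F:
  assumes "\<And>n. fps_nth x n \<in> U_pm_F S R s" "\<And>n. fps_nth y n \<in> U_pm_F S R s"
  shows "fps_nth (x * y) n \<in> U_pm_F S R s"
  unfolding fps_mult_nth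
  by (rule complex_vector.subspace_sum[OF subspace_U_pm_F]) (intro mult_mem_U_pm_F assms)

lemma exp_t_mem_U_pm_F: "X \<in> U_pm_F S R s \<Longrightarrow> fps_nth (exp_t c X) n \<in> U_pm_F S R s"
  unfolding exp_t_nth
  by (rule complex_vector.subspace_scale[OF subspace_U_pm_F power_mem_U_pm_F])

lemma m_pm_mem_U_pm_F: "m_pm S R s H \<in> U_pm_F S R s"
proof -
  have "m_pm S R s H \<in> complex_vector.span {elem (R_pm S R s b) a | a b. True}"
    unfolding m_pm_def by (rule tensor_lift_in_span) (intro lin_intros)
  also have "\<dots> \<subseteq> U_pm_F S R s"
    by (rule complex_vector.span_minimal[OF _ subspace_U_pm_F]) (auto intro: elem_mem_U_pm_F)
  finally show ?thesis .
qed

lemma M_pm_mem_U_pm_F: "M_pm S R s H \<in> U_pm_F S R s"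
  unfolding M_pm_def
  by (rule complex_vector.subspace_diff[OF subspace_U_pm_F elem_one_mem_U_pm_F m_pm_mem_U_pm_F])

section \<open>Commutation of \<open>m\<^sub>\<plusminus>\<close> with T and with each other\<close>

lemma app_m_pm: "app (m_pm S R s H) f = sweedler H (\<lambda>h\<^sub>1 h\<^sub>2. app (R_pm S R s h\<^sub>2) f *\<^sub>C h\<^sub>1)"
  unfolding m_pm_def by (subst app_tensor_lift) (intro lin_intros, simp add: elem.rep_eq)

lemma m_pm_commute_T:
  assumes H: "H \<in> cocommutative"
  shows "m_pm S R s H * universal_T = universal_T * m_pm S R s H"
proof (rule conv_eqI)
  fix f
  have push: "tensor_lift B t * y = tensor_lift (\<lambda>a b. B a b * y) t"
      "y * tensor_lift B t = tensor_lift (\<lambda>a b. y * B a b) t"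
    if "cbilinear B" for B :: "'f \<Rightarrow> 'f \<Rightarrow> 'f" and t y
    by (rule clinear_apply_tensor_lift[OF _ that], intro lin_intros)+
  \<comment> \<open>Cocommutativity feeds the first leg of \<open>H\<close> into \<open>R_pm\<close>
    here, while \<open>right\<close> keeps the second leg there; this is the pattern of the exchange
    axioms.\<close>
  have left: "app (m_pm S R s H * universal_T) f =
      sweedler f (\<lambda>f\<^sub>1 f\<^sub>2. sweedler H (\<lambda>h\<^sub>1 h\<^sub>2. app (R_pm S R s h\<^sub>1) f\<^sub>1 *\<^sub>C (h\<^sub>2 * f\<^sub>2)))"
    unfolding app_times app_m_pm universal_T.rep_eq
    by (subst push, intro lin_intros, subst sweedler_cocommutative[OF H], intro lin_intros) simp
  have right: "app (universal_T * m_pm S R s H) f =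
      sweedler f (\<lambda>f\<^sub>1 f\<^sub>2. sweedler H (\<lambda>h\<^sub>1 h\<^sub>2. app (R_pm S R s h\<^sub>2) f\<^sub>2 *\<^sub>C (f\<^sub>1 * h\<^sub>1)))"
    unfolding app_times app_m_pm universal_T.rep_eq
    by (subst push, intro lin_intros) simp
  show "app (m_pm S R s H * universal_T) f = app (universal_T * m_pm S R s H) f"
  proof (cases s)
    case Plus
    show ?thesis
      unfolding left right unfolding Plus R_pm.simps R_plus.rep_eq
      \<comment> \<open>\<open>R_exchange\<close> applies with \<open>a = H\<close> and
        \<open>b = f\<close>, so the sums over \<open>H\<close> go outside. For \<open>Minus\<close>
        the roles are \<open>a = f\<close> and \<open>b = H\<close>, and the order already
        fits.\<close>
      by (subst (1 2) tensor_lift_exchange; (intro lin_intros)?) (rule R_exchange)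
  next
    case Minus
    show ?thesis
      unfolding left right unfolding Minus R_pm.simps R_minus.rep_eq
      by (rule R_tilde_exchange)
  qed
qed

text \<open>Obtained by applying \<open>R_tilde(- \<otimes> a)\<close> to the exchange relation for \<open>R\<close>.\<close>

lemma R_plus_R_minus_exchange:
  "sweedler b (\<lambda>b\<^sub>1 b\<^sub>2. sweedler a (\<lambda>a\<^sub>1 a\<^sub>2.
      app (R_tilde S R) (b\<^sub>2 \<otimes> a\<^sub>2) *\<^sub>C (R_plus R b\<^sub>1 * R_minus S R a\<^sub>1))) =
   sweedler b (\<lambda>b\<^sub>1 b\<^sub>2. sweedler a (\<lambda>a\<^sub>1 a\<^sub>2.
      app (R_tilde S R) (b\<^sub>1 \<otimes> a\<^sub>1) *\<^sub>C (R_minus S R a\<^sub>2 * R_plus R b\<^sub>2)))"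
  (is "?L = ?R")
proof (rule conv_eqI)
  fix f :: 'f
  let ?R' = "\<lambda>x y. app (R_tilde S R) (x \<otimes> y)"
  \<comment> \<open>The antipode reverses the product, so \<open>y\<close> receives the first leg of
    \<open>a\<close>. Hence \<open>b\<^sub>2\<close> meets \<open>a\<^sub>2\<close> on one side of
    the relation and \<open>b\<^sub>1\<close> meets \<open>a\<^sub>1\<close> on the other.\<close>
  have R'_mult: "?R' (x * y) a = sweedler a (\<lambda>a\<^sub>1 a\<^sub>2. ?R' y a\<^sub>1 * ?R' x a\<^sub>2)" for x y
    by (simp add: app_R_tilde S_mult R_mult_left)
  have lin: "clinear (\<lambda>x. ?R' x a)"
    by (intro lin_intros)
  note push = clinear_apply_tensor_lift2[OF lin, symmetric]
  have scale: "c * ?R' x a = ?R' (c *\<^sub>C x) a" for c x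
    using clinear_scale[OF lin, of c x] by simp
  have pull: "c * sweedler x (\<lambda>u v. B u v) = sweedler x (\<lambda>u v. c * B u v)"
    if "cbilinear B" for c :: complex and x :: 'f and B
    using tensor_lift_scaleC_right[OF that, of c] by simp
  have "app ?L f = sweedler b (\<lambda>b\<^sub>1 b\<^sub>2. sweedler a (\<lambda>a\<^sub>1 a\<^sub>2. sweedler f (\<lambda>f\<^sub>1 f\<^sub>2.
      ?R' b\<^sub>2 a\<^sub>2 * (app R (b\<^sub>1 \<otimes> f\<^sub>1) * ?R' f\<^sub>2 a\<^sub>1))))"
    by (subst app_tensor_lift, intro lin_intros, subst app_tensor_lift, intro lin_intros)
      (simp add: scaleC_conv.rep_eq app_times R_plus.rep_eq R_minus.rep_eq pull lin_intros)
  also have "\<dots> = sweedler b (\<lambda>b\<^sub>1 b\<^sub>2. sweedler f (\<lambda>f\<^sub>1 f\<^sub>2. sweedler a (\<lambda>a\<^sub>1 a\<^sub>2.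
      ?R' b\<^sub>2 a\<^sub>2 * (app R (b\<^sub>1 \<otimes> f\<^sub>1) * ?R' f\<^sub>2 a\<^sub>1))))"
    by (subst tensor_lift_exchange) (intro lin_intros refl)+
  also have "\<dots> = sweedler b (\<lambda>b\<^sub>1 b\<^sub>2. sweedler f (\<lambda>f\<^sub>1 f\<^sub>2. app R (b\<^sub>1 \<otimes> f\<^sub>1) * ?R' (b\<^sub>2 * f\<^sub>2) a))"
    by (simp add: R'_mult pull lin_intros mult_ac)
  also have "\<dots> = sweedler b (\<lambda>b\<^sub>1 b\<^sub>2. sweedler f (\<lambda>f\<^sub>1 f\<^sub>2. app R (b\<^sub>2 \<otimes> f\<^sub>2) * ?R' (f\<^sub>1 * b\<^sub>1) a))"
    unfolding scale
    by (subst push, (intro lin_intros)+, subst push, (intro lin_intros)+, simp only: R_exchange)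
  also have "\<dots> = sweedler b (\<lambda>b\<^sub>1 b\<^sub>2. sweedler f (\<lambda>f\<^sub>1 f\<^sub>2. sweedler a (\<lambda>a\<^sub>1 a\<^sub>2.
      ?R' b\<^sub>1 a\<^sub>1 * (?R' f\<^sub>1 a\<^sub>2 * app R (b\<^sub>2 \<otimes> f\<^sub>2)))))"
    by (simp add: R'_mult pull lin_intros mult_ac)
  also have "\<dots> = sweedler b (\<lambda>b\<^sub>1 b\<^sub>2. sweedler a (\<lambda>a\<^sub>1 a\<^sub>2. sweedler f (\<lambda>f\<^sub>1 f\<^sub>2.
      ?R' b\<^sub>1 a\<^sub>1 * (?R' f\<^sub>1 a\<^sub>2 * app R (b\<^sub>2 \<otimes> f\<^sub>2)))))"
    by (subst tensor_lift_exchange) (intro lin_intros refl)+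
  also have "\<dots> = app ?R f"
    by (subst app_tensor_lift, intro lin_intros, subst app_tensor_lift, intro lin_intros)
      (simp add: scaleC_conv.rep_eq app_times R_plus.rep_eq R_minus.rep_eq pull lin_intros)
  finally show "app ?L f = app ?R f" .
qed

text \<open>Both orders of the product are values at \<open>H \<otimes> H\<close> of convolution
  products with values in \<open>U \<otimes> F\<close>: \<open>Z\<close> and \<open>Z'\<close> carry
  the U-factors in the two orders, \<open>pull_mult J\<close> and \<open>pull_mult_op J\<close> the
  F-factors. The trace exchange reverses both orders together.\<close>

lemma m_plus_commute_m_minus:
  assumes H: "H \<in> cocommutative"
  shows "m_pm S R Plus H * m_pm S R Minus H = m_pm S R Minus H * m_pm S R Plus H"
proof -
  define J :: "('f, ('f, 'f) conv) conv" where "J = Conv (elem 1)"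
  have app_J: "app J x = elem 1 x" for x
    unfolding J_def by (subst Conv_inverse) (auto intro: clinear_elem_right[OF clinear_id])
  define Z :: "(('f, 'f) tensor, ('f, 'f) conv) conv"
    where "Z = conv_lift (\<lambda>a b. elem (R_plus R a * R_minus S R b) 1)"
  define Z' :: "(('f, 'f) tensor, ('f, 'f) conv) conv"
    where "Z' = conv_lift (\<lambda>a b. elem (R_minus S R b * R_plus R a) 1)"
  have app_Z: "app Z (a \<otimes> b) = elem (R_plus R a * R_minus S R b) 1" for a b
    unfolding Z_def by (rule app_conv_lift_pure) (intro lin_intros)
  have app_Z': "app Z' (a \<otimes> b) = elem (R_minus S R b * R_plus R a) 1" for a b
    unfolding Z'_def by (rule app_conv_lift_pure) (intro lin_intros)
  have L: "clinear (\<lambda>X. elem X (1 :: 'f))"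
    by (intro lin_intros)
  have scale: "c *\<^sub>C elem X (1 :: 'f) = elem (c *\<^sub>C X) 1" for c and X :: "('f, complex) conv"
    by (rule clinear_scale[OF L, symmetric])
  note push = clinear_apply_tensor_lift2[OF L, symmetric]
  \<comment> \<open>The mixed exchange relation, carried into \<open>U \<otimes> F\<close> by the
    linear embedding of U as \<open>elem X 1\<close>.\<close>
  have Z: "Z * elem (R_tilde S R) 1 = elem (R_tilde S R) 1 * Z'"
    by (rule conv_tensor_eqI, simp add: app_times_pure elem.rep_eq app_Z app_Z' scale,
        subst push, (intro lin_intros)+, subst push, (intro lin_intros)+,
        simp only: R_plus_R_minus_exchange)
  have m: "m_pm S R s H = sweedler H (\<lambda>h\<^sub>1 h\<^sub>2. elem (R_pm S R s h\<^sub>1) h\<^sub>2)" for s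
    unfolding m_pm_def by (rule sweedler_cocommutative[OF H]) (intro lin_intros)
  have prod: "m_pm S R s H * m_pm S R s' H = sweedler H (\<lambda>h\<^sub>1 h\<^sub>2. sweedler H (\<lambda>k\<^sub>1 k\<^sub>2.
      elem (R_pm S R s h\<^sub>1 * R_pm S R s' k\<^sub>1) (h\<^sub>2 * k\<^sub>2)))" for s s'
  proof -
    have "clinear (\<lambda>X. X * m_pm S R s' H)"
      by (intro lin_intros)
    from clinear_apply_tensor_lift[OF this, of "\<lambda>h\<^sub>1 h\<^sub>2. elem (R_pm S R s h\<^sub>1) h\<^sub>2" "comult H"]
    have "m_pm S R s H * m_pm S R s' H =
        sweedler H (\<lambda>h\<^sub>1 h\<^sub>2. elem (R_pm S R s h\<^sub>1) h\<^sub>2 * m_pm S R s' H)"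
      by (simp add: m[of s] lin_intros)
    moreover have "elem (R_pm S R s h\<^sub>1) h\<^sub>2 * m_pm S R s' H =
        sweedler H (\<lambda>k\<^sub>1 k\<^sub>2. elem (R_pm S R s h\<^sub>1 * R_pm S R s' k\<^sub>1) (h\<^sub>2 * k\<^sub>2))" for h\<^sub>1 h\<^sub>2
    proof -
      have "clinear (\<lambda>X. elem (R_pm S R s h\<^sub>1) h\<^sub>2 * X)"
        by (intro lin_intros)
      from clinear_apply_tensor_lift[OF this, of "\<lambda>k\<^sub>1 k\<^sub>2. elem (R_pm S R s' k\<^sub>1) k\<^sub>2" "comult H"]
      show ?thesis
        by (simp add: m[of s'] lin_intros elem_mult)
    qed
    ultimately show ?thesis by simp
  qed
  have "m_pm S R Plus H * m_pm S R Minus H = app (Z * pull_mult J) (H \<otimes> H)"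
    by (simp add: prod app_times_pure app_Z app_pull_mult app_J elem_mult)
  also have "\<dots> = app (Z' * pull_mult_op J) (H \<otimes> H)"
    by (rule pull_mult_trace_exchange[OF tensor_pure_cocommutative[OF H H] Z])
  also have "\<dots> = sweedler H (\<lambda>h\<^sub>1 h\<^sub>2. sweedler H (\<lambda>k\<^sub>1 k\<^sub>2.
      elem (R_minus S R k\<^sub>1 * R_plus R h\<^sub>1) (k\<^sub>2 * h\<^sub>2)))"
    by (simp add: app_times_pure app_Z' app_pull_mult_op app_J elem_mult)
  also have "\<dots> = m_pm S R Minus H * m_pm S R Plus H"
    unfolding prod R_pm.simps by (rule tensor_lift_exchange) (intro lin_intros)+
  finally show ?thesis .
qed

section \<open>The factorization problem and its solutions\<close>

text \<open>The left factor is common to both signs and cancels in the quotient of the factorization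
  problem; it makes \<open>g_sol\<close> the solution of the differential equation driven by the
  evolved \<open>M_pm\<close>.\<close>

definition g_sol :: "'f \<Rightarrow> sign \<Rightarrow> ('f, 'f) conv fps" where
  "g_sol H s = exp_t (- \<i>) (elem 1 H) * exp_t \<i> (m_pm S R s H)"

definition g_inv :: "'f \<Rightarrow> sign \<Rightarrow> ('f, 'f) conv fps" where
  "g_inv H s = exp_t (- \<i>) (m_pm S R s H) * exp_t \<i> (elem 1 H)"

lemma inverse_pair_g: "inverse_pair (g_sol H s) (g_inv H s)"
  unfolding g_sol_def g_inv_def
  using inverse_pair_mult[OF inverse_pair_exp_t[of "- \<i>"] inverse_pair_exp_t[of \<i>]] by simp

lemma g_mem_U_pm_F:
  "fps_nth (g_sol H s) n \<in> U_pm_F S R s" "fps_nth (g_inv H s) n \<in> U_pm_F S R s"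
  unfolding g_sol_def g_inv_def
  by (intro fps_mult_mem_U_pm_F exp_t_mem_U_pm_F elem_one_mem_U_pm_F m_pm_mem_U_pm_F)+

lemma factorization_g:
  assumes "H \<in> cocommutative"
  shows "factorization S R H (g_sol H) (g_inv H)"
proof -
  let ?p = "m_pm S R Plus H" and ?m = "m_pm S R Minus H"
  have "g_inv H Minus * g_sol H Plus =
      exp_t (- \<i>) ?m * (exp_t \<i> (elem 1 H) * exp_t (- \<i>) (elem 1 H)) * exp_t \<i> ?p"
    by (simp only: g_inv_def g_sol_def mult.assoc)
  also have "\<dots> = exp_t \<i> (- ?m) * exp_t \<i> ?p"
    unfolding exp_t_inverse by (simp add: exp_t_minus)
  also have "\<dots> = exp_t \<i> (- ?m + ?p)"
    by (rule exp_t_add[symmetric]) (simp add: m_plus_commute_m_minus[OF assms])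
  finally show ?thesis
    by (simp add: factorization_def inverse_pair_g g_mem_U_pm_F)
qed

text \<open>Equal quotients give \<open>k Plus * g' Plus = k Minus * g' Minus\<close>; this common
  element \<open>h\<close> lies in both \<open>U\<^sub>+ \<otimes> F\<close> and
  \<open>U\<^sub>- \<otimes> F\<close>. Membership of the inverses \<open>g'\<close> is a separate
  assumption because \<open>factorization\<close> constrains only the factors themselves.\<close>

lemma factorization_unique:
  assumes g: "factorization S R H g g'" and k: "factorization S R H k k'"
    and g': "\<And>s n. fps_nth (g' s) n \<in> U_pm_F S R s"
  shows "\<exists>h h'. inverse_pair h h' \<and> (\<forall>s n. fps_nth h n \<in> U_pm_F S R s) \<and> (\<forall>s. k s = h * g s)"
proof -
  have inv: "inverse_pair (g s) (g' s)" "inverse_pair (k s) (k' s)" for s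
    using g k by (auto simp: factorization_def)
  define h where "h = k Plus * g' Plus"
  have "k' Minus * k Plus = g' Minus * g Plus"
    using g k by (simp add: factorization_def)
  then have "k Minus * (k' Minus * k Plus) * g' Plus = k Minus * (g' Minus * g Plus) * g' Plus"
    by simp
  then have "(k Minus * k' Minus) * (k Plus * g' Plus) = k Minus * g' Minus * (g Plus * g' Plus)"
    by (simp only: mult.assoc)
  then have "h = k Minus * g' Minus"
    by (simp add: inverse_pairD(1)[OF inv(1)] inverse_pairD(1)[OF inv(2)] h_def)
  then have h: "h = k s * g' s" for s
    by (cases s) (simp_all add: h_def)
  have "inverse_pair h (g Plus * k' Plus)"
    unfolding h_def by (intro inverse_pair_mult inv inverse_pair_commute)
  moreover have "fps_nth h n \<in> U_pm_F S R s" for s n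
    unfolding h[of s] by (rule fps_mult_mem_U_pm_F) (use k g' in \<open>auto simp: factorization_def\<close>)
  moreover have "k s = h * g s" for s
    by (simp add: h[of s] mult.assoc inverse_pairD(2)[OF inv(1)])
  ultimately show ?thesis by blast
qed

section \<open>Time evolution of T\<close>

text \<open>The factor \<open>exp_t \<i> m\<close> of \<open>g_sol\<close> commutes with T, so it
  cancels under conjugation and only the Heisenberg evolution is left.\<close>

lemma evolve_T_eq:
  assumes "H \<in> cocommutative"
  shows "evolve H universal_T = g_sol H s * fps_const universal_T * g_inv H s"
proof -
  let ?m = "m_pm S R s H" and ?T = "fps_const universal_T"
  have "g_sol H s * ?T * g_inv H s =
      exp_t (- \<i>) (elem 1 H) * (exp_t \<i> ?m * ?T) * exp_t (- \<i>) ?m * exp_t \<i> (elem 1 H)"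
    by (simp only: g_sol_def g_inv_def mult.assoc)
  also have "\<dots> = exp_t (- \<i>) (elem 1 H) * ?T * (exp_t \<i> ?m * exp_t (- \<i>) ?m) * exp_t \<i> (elem 1 H)"
    by (simp only: exp_t_commute[OF m_pm_commute_T[OF assms]] mult.assoc)
  finally show ?thesis
    by (simp add: exp_t_inverse evolve_def)
qed

lemma lax_evolve_T:
  assumes "H \<in> cocommutative"
  shows "lax_equation S R s H (evolve H universal_T)"
  using conj_flow_deriv conj_flow_commutator_eq[OF m_pm_commute_T[OF assms, of s]]
  by (simp add: lax_equation_def evolve_def M_pm_def conj_flow_def)

end

theorem theorem2p1:
  fixes V :: "'v set"
    and el eu :: "'v \<Rightarrow> 'f::{complex_algebra_1, complex_coalgebra}"
    and S :: "'f \<Rightarrow> 'f"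
    and R :: "(('f, 'f) tensor, complex) conv"
  assumes "coquasitriangular_face_hopf_algebra V el eu S R"
  shows
    "(complex_vector.subspace (cocommutative :: 'f set) \<and>
      (\<forall>a\<in>cocommutative. \<forall>b\<in>cocommutative. a * b \<in> (cocommutative :: 'f set) \<and> a * b = b * a)) \<and>
     (\<forall>H\<in>cocommutative.
       (\<forall>X. fps_nth X 0 = universal_T \<and> heisenberg_equation H X \<longleftrightarrow> X = evolve H universal_T) \<and>
       (\<forall>s. M_pm S R s H \<in> U_pm_F S R s \<and> lax_equation S R s H (evolve H universal_T))) \<and>
     (\<forall>H\<in>cocommutative. \<exists>g g'.
       factorization S R H g g' \<and>
       (\<forall>k k'. factorization S R H k k' \<longrightarrow>
         (\<exists>h h'. inverse_pair h h' \<and> (\<forall>s n. fps_nth h n \<in> U_pm_F S R s) \<and> (\<forall>s. k s = h * g s))) \<and>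
       (\<forall>s. evolve H universal_T = g s * fps_const universal_T * g' s \<and>
            lax_equation S R s H (g s * fps_const universal_T * g' s)) \<and>
       (\<forall>s. g s = exp_t (- \<i>) (elem 1 H) * exp_t \<i> (elem 1 H - M_pm S R s H)) \<and>
       (\<forall>s x. (fps_nth x 0 = 1 \<and> \<i> *\<^sub>C fps_deriv x = evolve H (M_pm S R s H) * x) \<longleftrightarrow> x = g s))"
proof -
  interpret coquasitriangular_face_hopf_algebra V el eu S R
    by (rule assms)
  have evolve: "evolve H X = conj_flow (elem 1 H) X" for H :: 'f and X
    by (simp add: evolve_def conj_flow_def)
  have ode: "(fps_nth x 0 = 1 \<and> \<i> *\<^sub>C fps_deriv x = evolve H (M_pm S R s H) * x) \<longleftrightarrow> x = g_sol H s"
    for H s x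
    unfolding evolve M_pm_def g_sol_def by (rule interaction_flow_unique)
  show ?thesis
  \<comment> \<open>Goals 1 to 3 make up (i), goals 4 to 6 make up (ii), and goal 7 is
    (iii).\<close>
  proof (intro conjI ballI allI, goal_cases)
    case 1
    show ?case by (rule subspace_cocommutative)
  next
    case (2 a b)
    then show ?case by (rule mult_cocommutative)
  next
    case (3 a b)
    then show ?case by (rule commute_cocommutative)
  next
    case (4 H X)
    show ?case
      unfolding heisenberg_equation_def evolve by (rule conj_flow_unique)
  next
    case (5 H s)
    show ?case by (rule M_pm_mem_U_pm_F)
  next
    case (6 H s)
    then show ?case by (rule lax_evolve_T)
  next
    case (7 H)
    show ?case
    proof (rule exI[of _ "g_sol H"], rule exI[of _ "g_inv H"], intro conjI allI impI)
      show "factorization S R H (g_sol H) (g_inv H)"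
        by (rule factorization_g[OF 7])
      show "\<exists>h h'. inverse_pair h h' \<and> (\<forall>s n. fps_nth h n \<in> U_pm_F S R s) \<and> (\<forall>s. k s = h * g_sol H s)"
        if "factorization S R H k k'" for k k'
        by (rule factorization_unique[OF factorization_g[OF 7] that g_mem_U_pm_F(2)])
      show "evolve H universal_T = g_sol H s * fps_const universal_T * g_inv H s" for s
        by (rule evolve_T_eq[OF 7])
      show "lax_equation S R s H (g_sol H s * fps_const universal_T * g_inv H s)" for s
        using lax_evolve_T[OF 7] by (simp add: evolve_T_eq[OF 7, of s])
      show "g_sol H s = exp_t (- \<i>) (elem 1 H) * exp_t \<i> (elem 1 H - M_pm S R s H)" for s
        by (simp add: g_sol_def M_pm_def)
    qed (rule ode)
  qed
qed

end
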